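(* Let $G$ be an arbitrary finitely generated commutative semigroup and let $S$ be any finite system of generators of $G$. Then the absolute $\mathscr{A}_S(G)$ is compact, and its main part is homeomorphic to the open disk whose dimension is one less than the rank of the group of fractions of $G$ if $G$ is a branching semigroup and $S$ is an admissible system of generators, and is equal to the rank of the group of fractions of $G$ otherwise.
   Context: A finite system of generators $S$ of a commutative semigroup $G$ (written additively) is a finite nonempty family of elements of $G$, repetitions allowed (repeated elements being treated as distinct members of $S$), generating $G$ (if $G$ has an identity element, the identity need not be a sum of a nonempty sequence of members of $S$). Let $G^1=G$ if $G$ has an identity element, and otherwise let $G^1$ be $G$ with an identity element adjoined; denote the identity by $0$. The Cayley graph of $(G,S)$ has vertex set $G^1$ and, for every vertex $g$ and every $s\in S$, a directed edge marked by $s$ from $g$ to $g+s$; the distinguished vertex is $0$. The space $\mathscr{P}$ of infinite paths starting at $0$ is identified, via sequences of edge marks, with $S^{\mathbb{N}}$ with the product topology. The measure of a finite path starting at $0$ is the measure of the cylinder of all infinite paths beginning with it. A Borel probability measure $\nu$ on $\mathscr{P}$ is central if for every vertex $v$ and every positive integer $n$, $\nu$ takes the same value on all paths of length $n$ leading from $0$ to $v$. A central measure is ergodic if it is an extreme point of the convex compact set of central measures. The absolute $\mathscr{A}_S(G)$ is the set of all ergodic central measures, with the topology induced by the weak topology on Borel probability measures on $\mathscr{P}$. The main part of the absolute is the subset of nondegenerate measures, i.e. those ergodic central measures for which every finite path starting at $0$ has nonzero measure. The group of fractions of $G$ is the group with the same generators as $G$ in which the relations are all corollaries of the relations in $G$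 (the Grothendieck group of $G$). The rank of a commutative group $A$ is $\dim_{\mathbb{Q}}(A\otimes\mathbb{Q})$. A graph with a distinguished vertex is a branching graph if for each vertex $v$ the set of paths from the distinguished vertex to $v$ is nonempty and all these paths have the same length. A branching monoid is a monoid whose Cayley graph with respect to some system of generators is a branching graph; a branching semigroup is a branching monoid or a semigroup obtained from a branching monoid by removing the identity element. In a branching semigroup there is a canonical generating set, consisting of all irreducible elements (non-identity elements that are not sums of two non-identity elements). A system of generators is admissible if it is built from this canonical set, i.e. each of its members is irreducible (each irreducible element occurring, possibly with multiplicity). The $0$-dimensional open disk is a point. *)

theory Defs
  imports
    "HOL-Probability.Probability"
    "HOL-Algebra.Group"
    "HOL-Library.Poly_Mapping"
    "Graph_Theory.Arc_Walk"
begin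

section \<open>Semigroups, systems of generators, Cayley graphs\<close>

text \<open>
  The semigroup \<open>G\<close> is a type of class \<^class>\<open>ab_semigroup_add\<close>.  The auxiliary notions are
  stated for a carrier with a binary operation, so that they also apply to the monoids occurring
  below, which are records of type \<^typ>\<open>'b monoid\<close>.
\<close>

definition neutral :: "'b set \<Rightarrow> ('b \<Rightarrow> 'b \<Rightarrow> 'b) \<Rightarrow> 'b \<Rightarrow> bool" where
  "neutral A f e \<longleftrightarrow> e \<in> A \<and> (\<forall>x\<in>A. f e x = x \<and> f x e = x)"

inductive_set generated_by ::
    "('b \<Rightarrow> 'b \<Rightarrow> 'b) \<Rightarrow> 'i set \<Rightarrow> ('i \<Rightarrow> 'b) \<Rightarrow> 'b set"
  for f :: "'b \<Rightarrow> 'b \<Rightarrow> 'b" and I :: "'i set" and s :: "'i \<Rightarrow> 'b" where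
  single: "i \<in> I \<Longrightarrow> s i \<in> generated_by f I s"
| step: "x \<in> generated_by f I s \<Longrightarrow> i \<in> I \<Longrightarrow> f x (s i) \<in> generated_by f I s"

text \<open>
  A system of generators is a finite nonempty indexed family, so repetitions are allowed.
  An identity element, if there is one, need not be a sum of generators.
\<close>

definition system_of_generators ::
    "'b set \<Rightarrow> ('b \<Rightarrow> 'b \<Rightarrow> 'b) \<Rightarrow> 'i set \<Rightarrow> ('i \<Rightarrow> 'b) \<Rightarrow> bool" where
  "system_of_generators A f I s \<longleftrightarrow>
     finite I \<and> I \<noteq> {} \<and> s ` I \<subseteq> A \<and>
     (\<forall>x\<in>A. neutral A f x \<or> x \<in> generated_by f I s)"

text \<open>The arc \<open>(g, i)\<close> leads from \<open>g\<close> to \<open>g + s i\<close>; its mark is the index \<open>i\<close>.\<close>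

definition cayley_graph ::
    "'b monoid \<Rightarrow> 'i set \<Rightarrow> ('i \<Rightarrow> 'b) \<Rightarrow> ('b, 'b \<times> 'i) pre_digraph" where
  "cayley_graph M I s =
     \<lparr>verts = carrier M, arcs = carrier M \<times> I, tail = fst, head = (\<lambda>(g, i). mult M g (s i))\<rparr>"

definition branching_graph :: "('v, 'e) pre_digraph \<Rightarrow> 'v \<Rightarrow> bool" where
  "branching_graph D v\<^sub>0 \<longleftrightarrow>
     (\<forall>v\<in>verts D. (\<exists>p. pre_digraph.awalk D v\<^sub>0 p v) \<and>
        (\<forall>p q. pre_digraph.awalk D v\<^sub>0 p v \<longrightarrow> pre_digraph.awalk D v\<^sub>0 q v \<longrightarrow> length p = length q))"

text \<open>Finite families are indexed, without loss of generality, by finite sets of naturals.\<close>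

definition branching_monoid :: "'b monoid \<Rightarrow> bool" where
  "branching_monoid M \<longleftrightarrow> comm_monoid M \<and>
     (\<exists>(I :: nat set) s. system_of_generators (carrier M) (mult M) I s \<and>
        branching_graph (cayley_graph M I s) (one M))"

text \<open>
  In the second alternative \<open>G\<close> is isomorphic to \<open>M\<close> without its identity element; such an \<open>M\<close>
  has exactly one element more than \<open>G\<close> and so can be realised on \<^typ>\<open>'a option\<close>.
\<close>

definition branching_semigroup :: "'a::ab_semigroup_add itself \<Rightarrow> bool" where
  "branching_semigroup _ \<longleftrightarrow>
     (\<exists>e::'a. branching_monoid \<lparr>carrier = UNIV, mult = (+), one = e\<rparr>) \<or>
     (\<exists>(M :: 'a option monoid) \<phi>. branching_monoid M \<and>
        bij_betw \<phi> (UNIV :: 'a set) (carrier M - {one M}) \<and>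
        (\<forall>a b. \<phi> (a + b) = mult M (\<phi> a) (\<phi> b)))"

definition irreducible_elements :: "'a::ab_semigroup_add set" where
  "irreducible_elements =
     {x. \<not> neutral UNIV (+) x \<and>
         \<not> (\<exists>a b. \<not> neutral UNIV (+) a \<and> \<not> neutral UNIV (+) b \<and> x = a + b)}"

definition admissible :: "('i \<Rightarrow> 'a::ab_semigroup_add) \<Rightarrow> bool" where
  "admissible s \<longleftrightarrow> range s = irreducible_elements"

fun option_add :: "'a::ab_semigroup_add option \<Rightarrow> 'a option \<Rightarrow> 'a option" where
  "option_add None y = y"
| "option_add (Some a) None = Some a"
| "option_add (Some a) (Some b) = Some (a + b)"

text \<open>
  The monoid \<open>G\<^sup>1\<close>: its elements are \<^term>\<open>Some g\<close> for \<open>g\<close> in \<open>G\<close>, together with the adjoined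
  identity \<^term>\<open>None\<close> in case \<open>G\<close> has no identity element.
\<close>

definition unitization :: "'a::ab_semigroup_add option monoid" where
  "unitization =
     (if \<exists>e::'a. neutral UNIV (+) e
      then \<lparr>carrier = range Some, mult = option_add,
            one = Some (THE e. neutral UNIV (+) e)\<rparr>
      else \<lparr>carrier = UNIV, mult = option_add, one = None\<rparr>)"

section \<open>The group of fractions\<close>

text \<open>
  Classes of pairs \<open>(a, b)\<close>, standing for \<open>a - b\<close>.  The extra summand \<open>k\<close> is needed because
  \<open>G\<close> need not be cancellative.
\<close>

definition fraction_rel :: "'a::ab_semigroup_add \<times> 'a \<Rightarrow> 'a \<times> 'a \<Rightarrow> bool" where
  "fraction_rel x y \<longleftrightarrow> (\<exists>k. fst x + snd y + k = fst y + snd x + k)"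

lemma equivp_fraction_rel: "equivp (fraction_rel :: 'a::ab_semigroup_add \<times> 'a \<Rightarrow> _)"
proof (rule equivpI)
  show "reflp (fraction_rel :: 'a \<times> 'a \<Rightarrow> _)"
    by (auto simp: reflp_def fraction_rel_def)
  show "symp (fraction_rel :: 'a \<times> 'a \<Rightarrow> _)"
    by (auto simp: symp_def fraction_rel_def) metis
  show "transp (fraction_rel :: 'a \<times> 'a \<Rightarrow> _)"
  proof (rule transpI)
    fix x y z :: "'a \<times> 'a"
    assume "fraction_rel x y" "fraction_rel y z"
    then obtain k l where k: "fst x + snd y + k = fst y + snd x + k"
      and l: "fst y + snd z + l = fst z + snd y + l"
      by (auto simp: fraction_rel_def)
    have "fst x + snd z + (k + l + fst y + snd y) = (fst x + snd y + k) + (fst y + snd z + l)"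
      by (simp add: ac_simps)
    also have "\<dots> = (fst y + snd x + k) + (fst z + snd y + l)"
      by (simp only: k l)
    also have "\<dots> = fst z + snd x + (k + l + fst y + snd y)"
      by (simp add: ac_simps)
    finally show "fraction_rel x z"
      by (auto simp: fraction_rel_def)
  qed
qed

quotient_type (overloaded) 'a fraction_group = "'a::ab_semigroup_add \<times> 'a" / fraction_rel
  by (rule equivp_fraction_rel)

instantiation fraction_group :: (ab_semigroup_add) ab_group_add
begin

lift_definition zero_fraction_group :: "'a fraction_group" is "(undefined, undefined)" .

lift_definition plus_fraction_group ::
    "'a fraction_group \<Rightarrow> 'a fraction_group \<Rightarrow> 'a fraction_group"
  is "\<lambda>x y. (fst x + fst y, snd x + snd y)"
proof -
  fix x x' y y' :: "'a \<times> 'a"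
  assume "fraction_rel x x'" "fraction_rel y y'"
  then obtain k l where k: "fst x + snd x' + k = fst x' + snd x + k"
    and l: "fst y + snd y' + l = fst y' + snd y + l"
    by (auto simp: fraction_rel_def)
  have "(fst x + fst y) + (snd x' + snd y') + (k + l)
      = (fst x + snd x' + k) + (fst y + snd y' + l)"
    by (simp add: ac_simps)
  also have "\<dots> = (fst x' + snd x + k) + (fst y' + snd y + l)"
    by (simp only: k l)
  also have "\<dots> = (fst x' + fst y') + (snd x + snd y) + (k + l)"
    by (simp add: ac_simps)
  finally show "fraction_rel (fst x + fst y, snd x + snd y) (fst x' + fst y', snd x' + snd y')"
    by (auto simp: fraction_rel_def)
qed

lift_definition uminus_fraction_group :: "'a fraction_group \<Rightarrow> 'a fraction_group"
  is "\<lambda>x. (snd x, fst x)"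
  by (auto simp: fraction_rel_def ac_simps) metis

definition minus_fraction_group ::
    "'a fraction_group \<Rightarrow> 'a fraction_group \<Rightarrow> 'a fraction_group"
  where "minus_fraction_group x y = x + - y"

instance
proof
  fix a b c :: "'a fraction_group"
  show "a + b + c = a + (b + c)"
    by transfer (auto simp: fraction_rel_def ac_simps)
  show "a + b = b + a"
    by transfer (auto simp: fraction_rel_def ac_simps)
  show "0 + a = a"
    by transfer (auto simp: fraction_rel_def ac_simps)
  show "- a + a = 0"
    by transfer (auto simp: fraction_rel_def ac_simps)
  show "a - b = a + - b"
    by (simp add: minus_fraction_group_def)
qed

end

section \<open>Tensor products over the integers and the rank of a commutative group\<close>

text \<open>
  The tensor product is the free commutative group on pairs, modulo the subgroup generated by
  the bilinearity relations.
\<close>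

inductive_set tensor_relations ::
    "('a::ab_group_add \<times> 'b::ab_group_add \<Rightarrow>\<^sub>0 int) set" where
  zero: "0 \<in> tensor_relations"
| diff: "x \<in> tensor_relations \<Longrightarrow> y \<in> tensor_relations \<Longrightarrow> x - y \<in> tensor_relations"
| left: "frag_of (a + a', b) - frag_of (a, b) - frag_of (a', b) \<in> tensor_relations"
| right: "frag_of (a, b + b') - frag_of (a, b) - frag_of (a, b') \<in> tensor_relations"

lemma tensor_relations_uminus: "x \<in> tensor_relations \<Longrightarrow> - x \<in> tensor_relations"
  using tensor_relations.diff[OF tensor_relations.zero] by simp

lemma tensor_relations_add:
  "x \<in> tensor_relations \<Longrightarrow> y \<in> tensor_relations \<Longrightarrow> x + y \<in> tensor_relations"
  using tensor_relations.diff[OF _ tensor_relations_uminus] by simp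

definition tensor_rel ::
    "('a::ab_group_add \<times> 'b::ab_group_add \<Rightarrow>\<^sub>0 int) \<Rightarrow> ('a \<times> 'b \<Rightarrow>\<^sub>0 int) \<Rightarrow> bool" where
  "tensor_rel x y \<longleftrightarrow> x - y \<in> tensor_relations"

lemma equivp_tensor_rel:
  "equivp (tensor_rel :: ('a::ab_group_add \<times> 'b::ab_group_add \<Rightarrow>\<^sub>0 int) \<Rightarrow> _)"
proof (rule equivpI)
  show "reflp (tensor_rel :: ('a \<times> 'b \<Rightarrow>\<^sub>0 int) \<Rightarrow> _)"
    by (auto simp: reflp_def tensor_rel_def tensor_relations.zero)
  show "symp (tensor_rel :: ('a \<times> 'b \<Rightarrow>\<^sub>0 int) \<Rightarrow> _)"
    using tensor_relations_uminus by (fastforce simp: symp_def tensor_rel_def)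
  show "transp (tensor_rel :: ('a \<times> 'b \<Rightarrow>\<^sub>0 int) \<Rightarrow> _)"
    using tensor_relations_add by (fastforce simp: transp_def tensor_rel_def)
qed

quotient_type (overloaded) ('a, 'b) tensor =
    "'a::ab_group_add \<times> 'b::ab_group_add \<Rightarrow>\<^sub>0 int" / tensor_rel
  by (rule equivp_tensor_rel)

instantiation tensor :: (ab_group_add, ab_group_add) ab_group_add
begin

lift_definition zero_tensor :: "('a, 'b) tensor" is 0 .

lift_definition plus_tensor :: "('a, 'b) tensor \<Rightarrow> ('a, 'b) tensor \<Rightarrow> ('a, 'b) tensor" is "(+)"
proof -
  fix x x' y y' :: "'a \<times> 'b \<Rightarrow>\<^sub>0 int"
  assume "tensor_rel x x'" "tensor_rel y y'"
  then have "(x - x') + (y - y') \<in> tensor_relations"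
    unfolding tensor_rel_def by (rule tensor_relations_add)
  then show "tensor_rel (x + y) (x' + y')"
    by (simp add: tensor_rel_def algebra_simps)
qed

lift_definition uminus_tensor :: "('a, 'b) tensor \<Rightarrow> ('a, 'b) tensor" is uminus
  using tensor_relations_uminus by (fastforce simp: tensor_rel_def)

definition minus_tensor :: "('a, 'b) tensor \<Rightarrow> ('a, 'b) tensor \<Rightarrow> ('a, 'b) tensor"
  where "minus_tensor x y = x + - y"

instance
proof
  fix a b c :: "('a, 'b) tensor"
  show "a + b + c = a + (b + c)"
    by transfer (simp add: tensor_rel_def tensor_relations.zero algebra_simps)
  show "a + b = b + a"
    by transfer (simp add: tensor_rel_def tensor_relations.zero algebra_simps)
  show "0 + a = a"
    by transfer (simp add: tensor_rel_def tensor_relations.zero)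
  show "- a + a = 0"
    by transfer (simp add: tensor_rel_def tensor_relations.zero)
  show "a - b = a + - b"
    by (simp add: minus_tensor_def)
qed

end

text \<open>The rational scalar action on the second factor: \<open>r (a \<otimes> q) = a \<otimes> (r q)\<close>.\<close>

lift_definition tensor_scale ::
    "rat \<Rightarrow> ('a::ab_group_add, rat) tensor \<Rightarrow> ('a, rat) tensor"
  is "\<lambda>r. frag_extend (\<lambda>(a, q). frag_of (a, r * q))"
proof -
  fix r and x y :: "'a \<times> rat \<Rightarrow>\<^sub>0 int"
  let ?f = "frag_extend (\<lambda>(a :: 'a, q :: rat). frag_of (a, r * q))"
  assume "tensor_rel x y"
  have "?f z \<in> tensor_relations" if "z \<in> tensor_relations" for z
    using that
    by induction
      (auto simp: frag_extend_diff ring_distribs intro: tensor_relations.intros)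
  with \<open>tensor_rel x y\<close> show "tensor_rel (?f x) (?f y)"
    by (simp add: tensor_rel_def flip: frag_extend_diff)
qed

lemma vector_space_tensor_scale:
  "vector_space (tensor_scale :: rat \<Rightarrow> ('a::ab_group_add, rat) tensor \<Rightarrow> _)"
proof
  fix a b :: rat and x y :: "('a, rat) tensor"
  show "tensor_scale a (x + y) = tensor_scale a x + tensor_scale a y"
    by transfer (simp add: frag_extend_add tensor_rel_def tensor_relations.zero)
  show "tensor_scale (a + b) x = tensor_scale a x + tensor_scale b x"
  proof (transfer fixing: a b)
    fix z :: "'a \<times> rat \<Rightarrow>\<^sub>0 int"
    have "frag_extend (\<lambda>(u, q). frag_of (u, (a + b) * q)) z
        - (frag_extend (\<lambda>(u, q). frag_of (u, a * q)) z
           + frag_extend (\<lambda>(u, q). frag_of (u, b * q)) z) \<in> tensor_relations"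
      (is "?F z \<in> _")
      using subset_UNIV
    proof (induction z rule: frag_induction)
      case (diff x y)
      have "?F (x - y) = ?F x - ?F y"
        by (simp add: frag_extend_diff)
      then show ?case
        using diff by (metis tensor_relations.diff)
    next
      case (one x)
      obtain u q where "x = (u, q)" by (cases x)
      then show ?case
        using tensor_relations.right[of u "a * q" "b * q"]
        by (simp add: ring_distribs diff_diff_add)
    qed (auto simp: tensor_relations.zero)
    then show "tensor_rel (frag_extend (\<lambda>(u, q). frag_of (u, (a + b) * q)) z)
      (frag_extend (\<lambda>(u, q). frag_of (u, a * q)) z + frag_extend (\<lambda>(u, q). frag_of (u, b * q)) z)"
      by (simp add: tensor_rel_def)
  qed
  show "tensor_scale a (tensor_scale b x) = tensor_scale (a * b) x"
  proof (transfer fixing: a b)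
    fix z :: "'a \<times> rat \<Rightarrow>\<^sub>0 int"
    have "frag_extend (\<lambda>(u, q). frag_of (u, a * q)) (frag_extend (\<lambda>(u, q). frag_of (u, b * q)) z)
        = frag_extend (\<lambda>(u, q). frag_of (u, a * b * q)) z"
      using subset_UNIV by (induction z rule: frag_induction)
        (auto simp: frag_extend_diff mult.assoc)
    then show "tensor_rel
        (frag_extend (\<lambda>(u, q). frag_of (u, a * q)) (frag_extend (\<lambda>(u, q). frag_of (u, b * q)) z))
        (frag_extend (\<lambda>(u, q). frag_of (u, a * b * q)) z)"
      by (simp add: tensor_rel_def tensor_relations.zero)
  qed
  show "tensor_scale 1 x = x"
  proof transfer
    fix z :: "'a \<times> rat \<Rightarrow>\<^sub>0 int"
    have "frag_extend (\<lambda>(u, q). frag_of (u, 1 * q)) z = z"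
      using subset_UNIV by (induction z rule: frag_induction) (auto simp: frag_extend_diff)
    then show "tensor_rel (frag_extend (\<lambda>(u, q). frag_of (u, 1 * q)) z) z"
      by (simp add: tensor_rel_def tensor_relations.zero)
  qed
qed

definition abelian_rank :: "'b::ab_group_add itself \<Rightarrow> nat" where
  "abelian_rank _ = vector_space.dim tensor_scale (UNIV :: ('b, rat) tensor set)"

section \<open>Central measures and the absolute\<close>

text \<open>
  For a finite type of class \<^class>\<open>discrete_topology\<close> the topology of \<^typ>\<open>nat \<Rightarrow> 'i\<close> is the
  product of discrete topologies, and infinite paths are identified with their sequences of marks.
\<close>

definition path_to ::
    "('i \<Rightarrow> 'a::ab_semigroup_add) \<Rightarrow> ('a option \<times> 'i) list \<Rightarrow> 'a option \<Rightarrow> bool" where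
  "path_to s p v \<longleftrightarrow>
     pre_digraph.awalk (cayley_graph unitization UNIV (Some \<circ> s)) (one unitization) p v"

definition cylinder :: "('v \<times> 'i) list \<Rightarrow> (nat \<Rightarrow> 'i) set" where
  "cylinder p = {\<omega>. \<forall>k<length p. \<omega> k = snd (p ! k)}"

definition borel_probs :: "'b::topological_space measure set" where
  "borel_probs = {\<nu>. prob_space \<nu> \<and> sets \<nu> = sets borel}"

definition weak_topology :: "'b::topological_space measure topology" where
  "weak_topology = topology_generated_by
     {{\<nu> \<in> borel_probs. (\<integral>x. f x \<partial>\<nu>) \<in> U} | (f :: 'b \<Rightarrow> real) U.
        continuous_on UNIV f \<and> bounded (range f) \<and> open U}"

definition central_measures ::
    "('i::discrete_topology \<Rightarrow> 'a::ab_semigroup_add) \<Rightarrow> (nat \<Rightarrow> 'i) measure set" where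
  "central_measures s = {\<nu> \<in> borel_probs.
     \<forall>v\<in>carrier unitization. \<forall>n>0. \<forall>p q.
       path_to s p v \<and> length p = n \<and> path_to s q v \<and> length q = n \<longrightarrow>
       measure \<nu> (cylinder p) = measure \<nu> (cylinder q)}"

text \<open>
  Extreme points; the type of measures is not a real vector space, so convex combinations
  are written out setwise.
\<close>

definition absolute ::
    "('i::discrete_topology \<Rightarrow> 'a::ab_semigroup_add) \<Rightarrow> (nat \<Rightarrow> 'i) measure set" where
  "absolute s = {\<nu> \<in> central_measures s.
     \<not> (\<exists>\<mu>\<^sub>1\<in>central_measures s. \<exists>\<mu>\<^sub>2\<in>central_measures s. \<exists>t::real.
          \<mu>\<^sub>1 \<noteq> \<mu>\<^sub>2 \<and> 0 < t \<and> t < 1 \<and>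
          (\<forall>A\<in>sets borel. measure \<nu> A = (1 - t) * measure \<mu>\<^sub>1 A + t * measure \<mu>\<^sub>2 A))}"

definition absolute_main_part ::
    "('i::discrete_topology \<Rightarrow> 'a::ab_semigroup_add) \<Rightarrow> (nat \<Rightarrow> 'i) measure set" where
  "absolute_main_part s = {\<nu> \<in> absolute s. \<forall>p v. path_to s p v \<longrightarrow> measure \<nu> (cylinder p) \<noteq> 0}"

definition open_disk :: "nat \<Rightarrow> (nat \<Rightarrow> real) topology" where
  "open_disk d = subtopology (Euclidean_space d) {x. (\<Sum>i<d. (x i)\<^sup>2) < 1}"

end

theory Submission
  imports Defs
begin

text \<open>
  Centrality makes a measure \<open>\<nu>\<close> tail invariant, so it is a mixture of its conditionals on the first
  mark, which are again central; extremality forces them to coincide, and \<open>\<nu>\<close> is a Bernoulli measure.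
  Conversely, let a Bernoulli measure be a convex combination of central measures. Covariances
  of the marks are nonnegative for central measures and vanish for the Bernoulli measure, so they vanish
  for the summands; a second moment estimate then shows that each mark is independent of the past.  Hence the
  absolute is the image of the compact set of probability vectors \<open>p\<close> satisfying the homogeneous binomial
  relations of the generators.

  On the main part \<open>p\<close> is positive and \<open>x = ln p\<close> ranges over a linear space \<open>L\<close> containing the
  constants, subject to \<open>\<Sum> exp x = 1\<close>; so the main part is \<open>L\<close> modulo constants.  Additive functions on
  \<open>G\<close> form a subspace \<open>H\<close> of \<open>L\<close> whose dimension is the rank of the group of fractions.  If some relation
  has sides of different lengths, \<open>L\<close> is the direct sum of \<open>H\<close> and the constants.  Otherwise
  \<open>L = H\<close> contains the constants, and this is the case of a branching semigroup with admissible generators.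
\<close>

text \<open>Centrality compares only words of equal length, whereas the group of fractions sees all
  relations. One relation with sides of different lengths bridges this gap: suitable multiples of it
  turn any other relation into one of equal lengths.

  The obstacle is extremality of Bernoulli measures, since the summands of a convex combination are
  arbitrary central measures and no integral decomposition is invoked. The moments in question are
  centred at the Bernoulli parameter instead of the mean of the measure under study. This keeps them
  affine in the measure, so they can be compared along the convex combination before anything is
  known about the summands. Commutativity supplies exchangeability: permuting marks changes neither
  sum nor length of a word.

  G may lack cancellation and an identity, and an identity need not be a sum of generators.
  Therefore sums of words live in an option type whose \<open>None\<close> is the empty sum, and the
  passage to the group of fractions is made through real additive functions, which vanish at an
  identity and are blind to failures of cancellation.\<close>

section \<open>Cylinders and the Borel sets of path space\<close>

definition cyl :: "'i list \<Rightarrow> (nat \<Rightarrow> 'i) set" where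
  "cyl w = {\<omega>. \<forall>k<length w. \<omega> k = w ! k}"

definition tail_path :: "(nat \<Rightarrow> 'i) \<Rightarrow> nat \<Rightarrow> 'i" where
  "tail_path \<omega> k = \<omega> (Suc k)"

text \<open>Only the marks of a path enter its cylinder, so words of marks can replace lists of arcs
  in all statements about measures.\<close>

lemma cylinder_eq_cyl: "cylinder p = cyl (map snd p)"
  by (auto simp: cylinder_def cyl_def)

lemma cyl_Nil [simp]: "cyl [] = UNIV"
  by (simp add: cyl_def)

lemma mem_cyl_iff: "\<omega> \<in> cyl w \<longleftrightarrow> map \<omega> [0..<length w] = w"
  unfolding cyl_def mem_Collect_eq by (subst list_eq_iff_nth_eq) simp

lemma cyl_Cons: "cyl (i # w) = {\<omega>. \<omega> 0 = i} \<inter> tail_path -` cyl w"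
proof -
  have "map \<omega> [0..<Suc n] = \<omega> 0 # map (tail_path \<omega>) [0..<n]" for \<omega> :: "nat \<Rightarrow> 'a" and n
    by (simp add: upt_conv_Cons map_Suc_upt[symmetric] tail_path_def comp_def del: upt_Suc)
  then show ?thesis
    by (auto simp: mem_cyl_iff simp del: upt_Suc)
qed

lemma cyl_snoc: "cyl (w @ [i]) = cyl w \<inter> {\<omega>. \<omega> (length w) = i}"
  by (auto simp: mem_cyl_iff)

lemma mem_cyl_prefix: "\<omega> \<in> cyl (map \<omega> [0..<n])"
  by (simp add: mem_cyl_iff)

lemma cyl_prefix_antimono:
  assumes "m \<le> n"
  shows "cyl (map \<omega> [0..<n]) \<subseteq> cyl (map \<omega> [0..<m])"
  using assms by (auto simp: mem_cyl_iff)

lemma finite_words: "finite {w :: 'i::finite list. length w = n}"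
  using finite_lists_length_eq[of "UNIV :: 'i set" n] by simp

text \<open>Two cylinders with a common point are nested, because the shorter word is a prefix of
  the longer one. Disjoint cylinders are the reason for inserting the empty set.\<close>

lemma Int_stable_cyl: "Int_stable (insert {} (range cyl))"
proof (rule Int_stableI)
  have *: "cyl u \<inter> cyl v \<in> insert {} (range cyl)" if "length u \<le> length v" for u v :: "'a list"
  proof (cases "cyl u \<inter> cyl v = {}")
    case False
    then obtain \<omega> where "\<omega> \<in> cyl u" "\<omega> \<in> cyl v"
      by blast
    then have "cyl v \<subseteq> cyl u"
      using cyl_prefix_antimono[OF that, of \<omega>] by (simp add: mem_cyl_iff)
    then show ?thesis
      by (simp add: Int_absorb1)
  qed simp
  fix A B :: "(nat \<Rightarrow> 'a) set"
  assume "A \<in> insert {} (range cyl)" "B \<in> insert {} (range cyl)"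
  then consider "A \<inter> B = {}" | u v where "A = cyl u" "B = cyl v"
    by blast
  then show "A \<inter> B \<in> insert {} (range cyl)"
  proof cases
    case 2
    then show ?thesis
      using *[of u v] *[of v u] linear[of "length u" "length v"] by (metis Int_commute)
  qed simp
qed

lemma open_cyl: "open (cyl w :: (nat \<Rightarrow> 'i::discrete_topology) set)"
proof -
  have "open {f :: nat \<Rightarrow> 'i. \<forall>i\<in>{..<length w}. f (id i) \<in> {w ! i}}"
    by (rule product_topology_basis') (auto simp: Topological_Spaces.open_discrete)
  then show ?thesis
    by (simp add: cyl_def Ball_def)
qed

lemma cyl_borel [measurable]: "cyl w \<in> sets (borel :: (nat \<Rightarrow> 'i::discrete_topology) measure)"
  by (simp add: open_cyl borel_open)

lemma open_contains_cyl:
  fixes U :: "(nat \<Rightarrow> 'i::discrete_topology) set"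
  assumes "open U" "\<omega> \<in> U"
  obtains n where "cyl (map \<omega> [0..<n]) \<subseteq> U"
proof -
  obtain X where X: "\<omega> \<in> Pi\<^sub>E UNIV X" "finite {i. X i \<noteq> UNIV}" "Pi\<^sub>E UNIV X \<subseteq> U"
    using product_topology_open_contains_basis[of "\<lambda>_. euclidean" UNIV U \<omega>] assms
    unfolding open_fun_def by auto
  obtain n where n: "\<And>i. X i \<noteq> UNIV \<Longrightarrow> i < n"
    using X(2) by (auto simp: finite_nat_set_iff_bounded)
  have "cyl (map \<omega> [0..<n]) \<subseteq> Pi\<^sub>E UNIV X"
  proof
    fix \<eta> assume "\<eta> \<in> cyl (map \<omega> [0..<n])"
    then have "\<eta> i \<in> X i" for i
      using X(1) n[of i] by (cases "X i = UNIV") (auto simp: cyl_def PiE_iff)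
    then show "\<eta> \<in> Pi\<^sub>E UNIV X"
      by auto
  qed
  with X(3) show thesis
    by (intro that[of n]) blast
qed

text \<open>A finite alphabet has only countably many words, so an open set, being the union of the
  cylinders inside it, is a countable union of cylinders.\<close>

lemma sets_borel_eq_cyl:
  "sets (borel :: (nat \<Rightarrow> 'i::{finite, discrete_topology}) measure)
    = sigma_sets UNIV (insert {} (range cyl))"
proof -
  have "U \<in> sigma_sets UNIV (insert {} (range cyl))" if "open U" for U :: "(nat \<Rightarrow> 'i) set"
  proof -
    have "U = (\<Union>w\<in>{w. cyl w \<subseteq> U}. cyl w)"
    proof (rule subset_antisym; rule subsetI)
      fix \<omega> assume "\<omega> \<in> U"
      then obtain n where "cyl (map \<omega> [0..<n]) \<subseteq> U"
        using open_contains_cyl[OF \<open>open U\<close>] by blast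
      then show "\<omega> \<in> (\<Union>w\<in>{w. cyl w \<subseteq> U}. cyl w)"
        using mem_cyl_prefix by blast
    qed blast
    also have "\<dots> \<in> sigma_sets UNIV (insert {} (range cyl))"
      by (intro sigma_sets_UNION) auto
    finally show ?thesis .
  qed
  then have "sigma_sets UNIV {U :: (nat \<Rightarrow> 'i) set. open U} \<subseteq> sigma_sets UNIV (insert {} (range cyl))"
    by (intro sigma_sets_mono) auto
  moreover have "sigma_sets UNIV (insert {} (range cyl)) \<subseteq> sigma_sets UNIV {U :: (nat \<Rightarrow> 'i) set. open U}"
    by (intro sigma_sets_mono) (auto simp: open_cyl intro: sigma_sets.Empty)
  moreover have "sets borel = sigma_sets UNIV {U :: (nat \<Rightarrow> 'i) set. open U}"
    by (simp add: borel_def)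
  ultimately show ?thesis
    by (simp only: subset_antisym)
qed

lemma borel_probs_eqI:
  fixes \<mu> \<nu> :: "(nat \<Rightarrow> 'i::{finite, discrete_topology}) measure"
  assumes "\<mu> \<in> borel_probs" "\<nu> \<in> borel_probs"
    and eq: "\<And>w. measure \<mu> (cyl w) = measure \<nu> (cyl w)"
  shows "\<mu> = \<nu>"
proof (rule measure_eqI_generator_eq[OF Int_stable_cyl, where \<Omega>=UNIV and A="\<lambda>_. cyl []"])
  interpret \<mu>: prob_space \<mu> using assms by (simp add: borel_probs_def)
  interpret \<nu>: prob_space \<nu> using assms by (simp add: borel_probs_def)
  fix X :: "(nat \<Rightarrow> 'i) set" assume "X \<in> insert {} (range cyl)"
  then show "emeasure \<mu> X = emeasure \<nu> X"
    by (auto simp: \<mu>.emeasure_eq_measure \<nu>.emeasure_eq_measure eq)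
next
  interpret \<mu>: prob_space \<mu> using assms by (simp add: borel_probs_def)
  show "emeasure \<mu> (cyl []) \<noteq> \<infinity>"
    by (simp add: \<mu>.emeasure_eq_measure)
qed (use assms in \<open>auto simp: borel_probs_def sets_borel_eq_cyl intro: range_eqI[of _ _ "[]"]\<close>)

lemma continuous_tail_path: "continuous_on UNIV (tail_path :: (nat \<Rightarrow> 'i::topological_space) \<Rightarrow> _)"
proof (rule continuous_on_coordinatewise_then_product)
  fix k
  show "continuous_on UNIV (\<lambda>\<omega> :: nat \<Rightarrow> 'i. tail_path \<omega> k)"
    unfolding tail_path_def by (rule continuous_on_product_coordinates)
qed

lemma tail_path_borel [measurable]: "tail_path \<in> borel \<rightarrow>\<^sub>M (borel :: (nat \<Rightarrow> 'i::topological_space) measure)"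
  by (rule borel_measurable_continuous_onI[OF continuous_tail_path])

lemma coordinate_borel [measurable]:
  "{\<omega>. \<omega> n = i} \<in> sets (borel :: (nat \<Rightarrow> 'i::discrete_topology) measure)"
proof -
  have "open {f :: nat \<Rightarrow> 'i. \<forall>j\<in>{n}. f (id j) \<in> {i}}"
    by (rule product_topology_basis') (auto simp: Topological_Spaces.open_discrete)
  then show ?thesis
    by (simp add: borel_open)
qed

lemma space_borel_probs: "\<nu> \<in> borel_probs \<Longrightarrow> space \<nu> = UNIV"
  using sets_eq_imp_space_eq[of \<nu> borel] by (simp add: borel_probs_def)

section \<open>Bernoulli measures\<close>

definition prob_vectors :: "('i::finite \<Rightarrow> real) set" where
  "prob_vectors = {p. (\<forall>i. 0 \<le> p i) \<and> sum p UNIV = 1}"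

text \<open>The weights of \<open>embed_pmf p\<close> are \<open>p\<close> only for \<open>p\<close>
  in \<open>prob_vectors\<close>; for other vectors the product is an unspecified, but still Borel,
  probability measure.\<close>

definition bernoulli :: "('i::finite \<Rightarrow> real) \<Rightarrow> (nat \<Rightarrow> 'i) measure" where
  "bernoulli p = PiM UNIV (\<lambda>_. measure_pmf (embed_pmf p))"

definition word_prod :: "('i \<Rightarrow> real) \<Rightarrow> 'i list \<Rightarrow> real" where
  "word_prod p w = prod_list (map p w)"

lemma word_prod_simps [simp]:
  "word_prod p [] = 1" "word_prod p (i # w) = p i * word_prod p w"
  "word_prod p (u @ v) = word_prod p u * word_prod p v"
  by (simp_all add: word_prod_def)

lemma word_prod_nonneg: "(\<And>i. 0 \<le> p i) \<Longrightarrow> 0 \<le> word_prod p w"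
  by (induction w) simp_all

lemma pmf_embed_prob_vector:
  assumes "p \<in> prob_vectors"
  shows "pmf (embed_pmf p) i = p i"
proof (rule pmf_embed_pmf)
  show "(\<integral>\<^sup>+ x. ennreal (p x) \<partial>count_space UNIV) = 1"
    using assms by (subst nn_integral_count_space_finite)
      (auto simp: prob_vectors_def)
qed (use assms in \<open>auto simp: prob_vectors_def\<close>)

lemma cyl_eq_prod_emb:
  "cyl w = prod_emb UNIV (\<lambda>_. measure_pmf q) {..<length w} (\<Pi>\<^sub>E k\<in>{..<length w}. {w ! k})"
  unfolding cyl_def prod_emb_iff set_eq_iff mem_Collect_eq restrict_PiE_iff by auto

text \<open>One inclusion holds because events on a single coordinate are open, the other because
  cylinders are finite-dimensional product events. It reconciles \<open>PiM\<close> with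
  \<open>borel_probs\<close>, which prescribes the Borel sigma-algebra.\<close>

lemma sets_bernoulli: "sets (bernoulli p) = sets (borel :: (nat \<Rightarrow> 'i::{finite, discrete_topology}) measure)"
proof
  have space: "space (bernoulli p) = UNIV"
    by (simp add: bernoulli_def space_PiM PiE_UNIV_domain)
  show "sets (bernoulli p) \<subseteq> sets (borel :: (nat \<Rightarrow> 'i) measure)"
    unfolding bernoulli_def sets_PiM_single
  proof (rule sets.sigma_sets_subset', safe)
    fix j :: nat and A :: "'i set"
    have "open {f :: nat \<Rightarrow> 'i. \<forall>k\<in>{j}. f (id k) \<in> A}"
      by (rule product_topology_basis') (auto simp: Topological_Spaces.open_discrete)
    then show "{f \<in> UNIV \<rightarrow>\<^sub>E space (measure_pmf (embed_pmf p)). f j \<in> A} \<in> sets borel"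
      by (simp add: borel_open PiE_UNIV_domain)
  next
    show "UNIV \<rightarrow>\<^sub>E space (measure_pmf (embed_pmf p)) \<in> sets (borel :: (nat \<Rightarrow> 'i) measure)"
      by (simp add: PiE_UNIV_domain)
  qed
  have "cyl w \<in> sets (bernoulli p)" for w :: "'i list"
    unfolding bernoulli_def cyl_eq_prod_emb[of w "embed_pmf p"]
    by (rule sets_PiM_I) simp_all
  moreover have "UNIV \<in> sets (bernoulli p)"
    using sets.top[of "bernoulli p"] by (simp only: space)
  ultimately show "sets (borel :: (nat \<Rightarrow> 'i) measure) \<subseteq> sets (bernoulli p)"
    unfolding sets_borel_eq_cyl by (intro sets.sigma_sets_subset') auto
qed

lemma bernoulli_borel_probs [simp]:
  "bernoulli (p :: 'i::{finite, discrete_topology} \<Rightarrow> real) \<in> borel_probs"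
proof -
  have "prob_space (bernoulli p)"
    unfolding bernoulli_def by (rule prob_space_PiM) (rule prob_space_measure_pmf)
  then show ?thesis
    by (simp add: borel_probs_def sets_bernoulli)
qed

lemma measure_bernoulli_cyl:
  assumes "p \<in> prob_vectors"
  shows "measure (bernoulli p) (cyl w) = word_prod p w"
proof -
  let ?M = "\<lambda>_ :: nat. measure_pmf (embed_pmf p)"
  have nonneg: "0 \<le> p i" for i
    using assms by (simp add: prob_vectors_def)
  have "cyl w = prod_emb UNIV ?M {..<length w} (\<Pi>\<^sub>E k\<in>{..<length w}. {w ! k})"
    by (rule cyl_eq_prod_emb)
  then have "emeasure (bernoulli p) (cyl w) = (\<Prod>k<length w. emeasure (?M k) {w ! k})"
    unfolding bernoulli_def
    by (simp only:) (rule emeasure_PiM_emb; simp add: prob_space_measure_pmf)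
  also have "\<dots> = (\<Prod>k<length w. ennreal (p (w ! k)))"
    by (simp add: emeasure_pmf_single pmf_embed_prob_vector[OF assms])
  also have "\<dots> = ennreal (word_prod p w)"
    unfolding word_prod_def prod.list_conv_set_nth
    by (subst prod_ennreal) (auto simp: nonneg atLeast0LessThan)
  finally show ?thesis
    by (simp add: measure_def word_prod_nonneg[OF nonneg])
qed

lemma measurable_tail_path:
  assumes "sets M = sets borel"
  shows "tail_path \<in> M \<rightarrow>\<^sub>M (borel :: (nat \<Rightarrow> 'i::topological_space) measure)"
  by (subst measurable_cong_sets[OF assms refl]) (rule tail_path_borel)

lemma prob_space_borel_probs: "\<nu> \<in> borel_probs \<Longrightarrow> prob_space \<nu>"
  and sets_borel_probs: "\<nu> \<in> borel_probs \<Longrightarrow> sets \<nu> = sets borel"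
  by (simp_all add: borel_probs_def)

section \<open>Words, endpoints of paths, central measures\<close>

text \<open>\<open>None\<close> is the empty sum alone and stays distinct from an identity element
  of G, so an equality of word sums never relates the empty word to a nonempty one.\<close>

primrec word_sum :: "('i \<Rightarrow> 'a::ab_semigroup_add) \<Rightarrow> 'i list \<Rightarrow> 'a option" where
  "word_sum s [] = None"
| "word_sum s (i # w) = option_add (Some (s i)) (word_sum s w)"

lemma option_add_None_right [simp]: "option_add x None = x"
  by (cases x) simp_all

lemma option_add_assoc: "option_add (option_add x y) z = option_add x (option_add y z)"
  by (cases x; cases y; cases z) (simp_all add: ac_simps)

lemma option_add_commute: "option_add x y = option_add y x"
  by (cases x; cases y) (simp_all add: ac_simps)

lemma option_add_left_commute: "option_add x (option_add y z) = option_add y (option_add x z)"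
  by (metis option_add_assoc option_add_commute)

lemmas option_add_ac = option_add_assoc option_add_commute option_add_left_commute

lemma word_sum_append [simp]: "word_sum s (u @ v) = option_add (word_sum s u) (word_sum s v)"
  by (induction u) (simp_all add: option_add_assoc)

lemma word_sum_eq_None_iff [simp]: "word_sum s w = None \<longleftrightarrow> w = []"
proof (cases w)
  case (Cons i v)
  then show ?thesis by (cases "word_sum s v") simp_all
qed simp

lemma word_sum_neq_Nil: "w \<noteq> [] \<Longrightarrow> \<exists>g. word_sum s w = Some g"
  using word_sum_eq_None_iff[of s w] by blast

lemma foldl_option_add:
  "foldl (\<lambda>g i. option_add g (Some (s i))) g w = option_add g (word_sum s w)"
  by (induction w arbitrary: g) (simp_all add: option_add_assoc)

text \<open>The starting vertex and the marks force the tails of all arcs, so a walk amounts to a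
  word. The general record \<open>M\<close> serves \<open>unitization\<close> as well as the monoids
  in \<open>branching_monoid\<close>.\<close>

lemma awalk_cayley_iff:
  assumes closed: "\<And>g i. g \<in> carrier M \<Longrightarrow> i \<in> I \<Longrightarrow> mult M g (t i) \<in> carrier M"
  shows "(\<exists>p. pre_digraph.awalk (cayley_graph M I t) g p v \<and> map snd p = w) \<longleftrightarrow>
    g \<in> carrier M \<and> set w \<subseteq> I \<and> v = foldl (\<lambda>g i. mult M g (t i)) g w"
proof (induction w arbitrary: g)
  case Nil
  show ?case
    by (auto simp: pre_digraph.awalk_def pre_digraph.cas.simps cayley_graph_def)
next
  case (Cons i w)
  let ?D = "cayley_graph M I t"
  have step: "pre_digraph.awalk ?D g ((h, j) # p) v \<longleftrightarrow>
      h = g \<and> g \<in> carrier M \<and> j \<in> I \<and> pre_digraph.awalk ?D (mult M g (t j)) p v" for h j p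
    using closed
    by (auto simp: pre_digraph.awalk_def pre_digraph.cas.simps cayley_graph_def)
  have "(\<exists>p. pre_digraph.awalk ?D g p v \<and> map snd p = i # w) \<longleftrightarrow>
      g \<in> carrier M \<and> i \<in> I \<and>
      (\<exists>p. pre_digraph.awalk ?D (mult M g (t i)) p v \<and> map snd p = w)" (is "?L \<longleftrightarrow> ?R")
  proof
    assume ?L
    then obtain p where p: "pre_digraph.awalk ?D g p v" "map snd p = i # w"
      by (elim exE conjE)
    from p(2) obtain h q where "p = (h, i) # q" "map snd q = w"
      unfolding map_eq_Cons_conv by force
    with p(1) show ?R
      by (auto simp: step)
  next
    assume R: ?R
    then obtain p where "pre_digraph.awalk ?D (mult M g (t i)) p v" "map snd p = w"
      by (elim exE conjE)
    with R show ?L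
      by (intro exI[of _ "(g, i) # p"]) (simp add: step)
  qed
  also have "\<dots> \<longleftrightarrow> g \<in> carrier M \<and> set (i # w) \<subseteq> I \<and> v = foldl (\<lambda>g i. mult M g (t i)) g (i # w)"
    unfolding Cons using closed by auto
  finally show ?case .
qed

lemma the_neutral: "neutral UNIV (+) e \<Longrightarrow> (THE e. neutral UNIV (+) e) = (e :: 'a::ab_semigroup_add)"
  by (rule the_equality) (auto simp: neutral_def, metis)

lemma mult_unitization: "mult unitization = option_add"
  by (simp add: unitization_def)

lemma unitization_closed:
  "g \<in> carrier unitization \<Longrightarrow> mult unitization g (Some a) \<in> carrier unitization"
  by (cases g) (auto simp: unitization_def)

lemma one_unitization_closed: "one unitization \<in> carrier unitization"
  by (simp add: unitization_def)

lemma option_add_one_unitization: "option_add (one unitization) (Some a) = Some (a :: 'a::ab_semigroup_add)"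
proof (cases "\<exists>e::'a. neutral UNIV (+) e")
  case True
  then obtain e :: 'a where e: "neutral UNIV (+) e" by blast
  then have "one unitization = Some e"
    using True by (simp add: unitization_def the_neutral)
  then show ?thesis
    using e by (simp add: neutral_def)
qed (simp add: unitization_def)

lemma path_to_iff:
  "(\<exists>p. path_to s p v \<and> map snd p = w) \<longleftrightarrow> v = option_add (one unitization) (word_sum s w)"
  unfolding path_to_def
  by (subst awalk_cayley_iff)
    (simp_all add: unitization_closed[unfolded mult_unitization] one_unitization_closed
      mult_unitization foldl_option_add)

lemma option_add_one_word_sum:
  "w \<noteq> [] \<Longrightarrow> option_add (one unitization) (word_sum s w) = word_sum s w"
  using word_sum_neq_Nil[of w s] option_add_one_unitization by auto

text \<open>The identity of \<open>unitization\<close> is felt only by the empty word: a path of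
  positive length ends at the \<open>word_sum\<close> of its marks, and two words of length zero
  coincide.\<close>

lemma central_measures_iff:
  "\<nu> \<in> central_measures s \<longleftrightarrow> \<nu> \<in> borel_probs \<and>
    (\<forall>u v. length u = length v \<longrightarrow> word_sum s u = word_sum s v \<longrightarrow>
      measure \<nu> (cyl u) = measure \<nu> (cyl v))"
proof (intro iffI conjI allI impI)
  fix u v
  assume \<nu>: "\<nu> \<in> central_measures s" and uv: "length u = length v" "word_sum s u = word_sum s v"
  show "measure \<nu> (cyl u) = measure \<nu> (cyl v)"
  proof (cases "u = []")
    case False
    then have "v \<noteq> []" using uv by auto
    obtain p where p: "path_to s p (word_sum s u)" "map snd p = u"
      using path_to_iff[of s "word_sum s u" u] option_add_one_word_sum[OF False] by metis
    obtain q where q: "path_to s q (word_sum s u)" "map snd q = v"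
      using path_to_iff[of s "word_sum s v" v] option_add_one_word_sum[OF \<open>v \<noteq> []\<close>] uv by metis
    have "word_sum s u \<in> carrier unitization"
      using word_sum_neq_Nil[OF False, of s] by (auto simp: unitization_def)
    moreover have "length p = length u" "length q = length u"
      using p q uv by auto
    ultimately show ?thesis
      using \<nu> p q False unfolding central_measures_def cylinder_eq_cyl
      by (auto dest!: bspec[of _ _ "word_sum s u"] spec[of _ "length u"])
  qed (use uv in simp)
next
  assume *: "\<nu> \<in> borel_probs \<and>
    (\<forall>u v. length u = length v \<longrightarrow> word_sum s u = word_sum s v \<longrightarrow>
      measure \<nu> (cyl u) = measure \<nu> (cyl v))"
  show "\<nu> \<in> central_measures s"
    unfolding central_measures_def cylinder_eq_cyl
  proof (intro CollectI conjI ballI allI impI)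
    fix v n p q
    assume n: "n > (0::nat)"
      and pq: "path_to s p v \<and> length p = n \<and> path_to s q v \<and> length q = n"
    have "v = option_add (one unitization) (word_sum s (map snd p))"
      "v = option_add (one unitization) (word_sum s (map snd q))"
      using pq path_to_iff[of s v] by metis+
    moreover have "map snd p \<noteq> []" "map snd q \<noteq> []"
      using n pq by auto
    ultimately have "word_sum s (map snd p) = word_sum s (map snd q)"
      by (metis option_add_one_word_sum)
    then show "measure \<nu> (cyl (map snd p)) = measure \<nu> (cyl (map snd q))"
      using * pq by simp
  qed (use * in simp)
qed (simp add: central_measures_def)

lemma measure_split_coordinate:
  fixes \<nu> :: "(nat \<Rightarrow> 'i::{finite, discrete_topology}) measure"
  assumes "\<nu> \<in> borel_probs" "A \<in> sets borel"
  shows "measure \<nu> A = (\<Sum>i\<in>UNIV. measure \<nu> (A \<inter> {\<omega>. \<omega> n = i}))"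
proof -
  interpret prob_space \<nu> by (rule prob_space_borel_probs[OF assms(1)])
  note sets = sets_borel_probs[OF assms(1)]
  have "measure \<nu> (\<Union>i\<in>UNIV. A \<inter> {\<omega>. \<omega> n = i}) = (\<Sum>i\<in>UNIV. measure \<nu> (A \<inter> {\<omega>. \<omega> n = i}))"
    by (rule finite_measure_finite_Union)
      (use assms(2) in \<open>auto simp: sets disjoint_family_on_def intro!: sets.Int coordinate_borel\<close>)
  moreover have "(\<Union>i\<in>UNIV. A \<inter> {\<omega>. \<omega> n = i}) = A"
    by auto
  ultimately show ?thesis
    by (simp only:)
qed

lemma measure_cyl_snoc:
  fixes \<nu> :: "(nat \<Rightarrow> 'i::{finite, discrete_topology}) measure"
  assumes "\<nu> \<in> borel_probs"
  shows "measure \<nu> (cyl w) = (\<Sum>i\<in>UNIV. measure \<nu> (cyl (w @ [i])))"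
  unfolding cyl_snoc by (rule measure_split_coordinate[OF assms cyl_borel])

lemma central_Cons_eq_snoc:
  assumes "\<nu> \<in> central_measures s"
  shows "measure \<nu> (cyl (i # w)) = measure \<nu> (cyl (w @ [i]))"
proof -
  have "word_sum s (i # w) = word_sum s (w @ [i])"
    by (simp add: option_add_commute)
  with assms show ?thesis
    unfolding central_measures_iff by (metis length_append_singleton length_Cons)
qed

text \<open>The preimage of \<open>cyl w\<close> under the shift is the union of the cylinders of
  \<open>i # w\<close>. By commutativity \<open>i\<close> can be moved to the end without changing
  the measure, and the cylinders of \<open>w @ [i]\<close> make up \<open>cyl w\<close> again.
  Cylinders determine the measure.\<close>

lemma central_tail_invariant:
  fixes s :: "'i::{finite, discrete_topology} \<Rightarrow> 'a::ab_semigroup_add"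
  assumes "\<nu> \<in> central_measures s" "A \<in> sets borel"
  shows "measure \<nu> (tail_path -` A) = measure \<nu> A"
proof -
  have \<nu>: "\<nu> \<in> borel_probs"
    using assms by (simp add: central_measures_iff)
  then interpret prob_space \<nu> by (rule prob_space_borel_probs)
  have sets: "sets \<nu> = sets borel" and space: "space \<nu> = UNIV"
    by (rule sets_borel_probs[OF \<nu>], rule space_borel_probs[OF \<nu>])
  have meas: "tail_path \<in> \<nu> \<rightarrow>\<^sub>M borel"
    by (rule measurable_tail_path) (simp only: sets sets_uniform_measure)
  have distr: "measure (distr \<nu> borel tail_path) B = measure \<nu> (tail_path -` B)" if "B \<in> sets borel" for B
    by (subst measure_distr[OF meas that]) (simp only: space Int_UNIV_right)
  have "distr \<nu> borel tail_path = \<nu>"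
  proof (rule borel_probs_eqI[OF _ \<nu>])
    show "distr \<nu> borel tail_path \<in> borel_probs"
      using prob_space_distr[OF meas] by (simp add: borel_probs_def)
    fix w :: "'i list"
    have "measure (distr \<nu> borel tail_path) (cyl w) = measure \<nu> (tail_path -` cyl w)"
      by (rule distr) (rule cyl_borel)
    also have "\<dots> = (\<Sum>i\<in>UNIV. measure \<nu> (tail_path -` cyl w \<inter> {\<omega>. \<omega> 0 = i}))"
      using measurable_sets[OF tail_path_borel cyl_borel, of w]
      by (intro measure_split_coordinate[OF \<nu>]) simp
    also have "\<dots> = (\<Sum>i\<in>UNIV. measure \<nu> (cyl (i # w)))"
      by (simp only: cyl_Cons Int_commute)
    also have "\<dots> = (\<Sum>i\<in>UNIV. measure \<nu> (cyl (w @ [i])))"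
      by (simp only: central_Cons_eq_snoc[OF assms(1)])
    also have "\<dots> = measure \<nu> (cyl w)"
      by (rule measure_cyl_snoc[OF \<nu>, symmetric])
    finally show "measure (distr \<nu> borel tail_path) (cyl w) = measure \<nu> (cyl w)" .
  qed
  then show ?thesis
    using distr[OF assms(2)] by (simp only:)
qed

section \<open>Ergodic central measures are the central Bernoulli measures\<close>

definition central_vectors :: "('i::finite \<Rightarrow> 'a::ab_semigroup_add) \<Rightarrow> ('i \<Rightarrow> real) set" where
  "central_vectors s = {p \<in> prob_vectors.
     \<forall>u v. length u = length v \<longrightarrow> word_sum s u = word_sum s v \<longrightarrow> word_prod p u = word_prod p v}"

text \<open>The conditional law of the tail given the first mark. A set \<open>J\<close> allows a
  mark and its complement to be treated alike.\<close>

definition conditioned_tail :: "(nat \<Rightarrow> 'i::topological_space) measure \<Rightarrow> 'i set \<Rightarrow> (nat \<Rightarrow> 'i) measure" where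
  "conditioned_tail \<nu> J = distr (uniform_measure \<nu> {\<omega>. \<omega> 0 \<in> J}) borel tail_path"

lemma initial_borel:
  "{\<omega>. \<omega> n \<in> J} \<in> sets (borel :: (nat \<Rightarrow> 'i::{finite, discrete_topology}) measure)"
proof -
  have "{\<omega>. \<omega> n \<in> J} = (\<Union>i\<in>J. {\<omega> :: nat \<Rightarrow> 'i. \<omega> n = i})"
    by auto
  also have "\<dots> \<in> sets borel"
    by (intro sets.finite_UN) auto
  finally show ?thesis .
qed

lemma
  fixes \<nu> :: "(nat \<Rightarrow> 'i::{finite, discrete_topology}) measure"
  assumes \<nu>: "\<nu> \<in> borel_probs" and pos: "measure \<nu> {\<omega>. \<omega> 0 \<in> J} \<noteq> 0"
  shows conditioned_tail_borel_probs: "conditioned_tail \<nu> J \<in> borel_probs"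
    and measure_conditioned_tail: "A \<in> sets borel \<Longrightarrow> measure (conditioned_tail \<nu> J) A
      = measure \<nu> ({\<omega>. \<omega> 0 \<in> J} \<inter> tail_path -` A) / measure \<nu> {\<omega>. \<omega> 0 \<in> J}"
proof -
  let ?J = "{\<omega>. \<omega> 0 \<in> J}"
  interpret prob_space \<nu> by (rule prob_space_borel_probs[OF \<nu>])
  have sets: "sets \<nu> = sets borel" and space: "space \<nu> = UNIV"
    by (rule sets_borel_probs[OF \<nu>], rule space_borel_probs[OF \<nu>])
  have J: "emeasure \<nu> ?J \<noteq> 0" "emeasure \<nu> ?J \<noteq> \<infinity>"
    using pos by (auto simp: emeasure_eq_measure)
  have meas: "tail_path \<in> uniform_measure \<nu> ?J \<rightarrow>\<^sub>M borel"
    by (rule measurable_tail_path) (simp only: sets sets_uniform_measure)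
  interpret U: prob_space "uniform_measure \<nu> ?J"
    by (rule prob_space_uniform_measure[OF J])
  show "conditioned_tail \<nu> J \<in> borel_probs"
    using U.prob_space_distr[OF meas] by (simp add: borel_probs_def conditioned_tail_def)
  assume A: "A \<in> sets borel"
  have *: "tail_path -` A \<in> sets \<nu>"
    unfolding sets using measurable_sets[OF tail_path_borel A] by simp
  have "measure (conditioned_tail \<nu> J) A = measure (uniform_measure \<nu> ?J) (tail_path -` A)"
    unfolding conditioned_tail_def
    by (subst measure_distr[OF meas A]) (simp only: space space_uniform_measure Int_UNIV_right)
  also have "\<dots> = measure \<nu> (?J \<inter> tail_path -` A) / measure \<nu> ?J"
    by (rule measure_uniform_measure[OF J *])
  finally show "measure (conditioned_tail \<nu> J) A
      = measure \<nu> (?J \<inter> tail_path -` A) / measure \<nu> ?J" .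
qed

text \<open>Prefixing one and the same mark to two words preserves equality of their lengths and of
  their sums; the measure in question is a sum of such prefixed cylinders over
  \<open>J\<close>.\<close>

lemma conditioned_tail_central:
  fixes s :: "'i::{finite, discrete_topology} \<Rightarrow> 'a::ab_semigroup_add"
  assumes \<nu>: "\<nu> \<in> central_measures s" and pos: "measure \<nu> {\<omega>. \<omega> 0 \<in> J} \<noteq> 0"
  shows "conditioned_tail \<nu> J \<in> central_measures s"
proof -
  have \<nu>': "\<nu> \<in> borel_probs"
    using \<nu> by (simp add: central_measures_iff)
  let ?J = "{\<omega> :: nat \<Rightarrow> 'i. \<omega> 0 \<in> J}"
  have *: "measure \<nu> (?J \<inter> tail_path -` cyl w) = (\<Sum>i\<in>UNIV. if i \<in> J then measure \<nu> (cyl (i # w)) else 0)"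
    for w
  proof -
    have "?J \<inter> tail_path -` cyl w \<in> sets borel"
      using measurable_sets[OF tail_path_borel cyl_borel, of w] initial_borel[of 0 J] by auto
    then have "measure \<nu> (?J \<inter> tail_path -` cyl w)
        = (\<Sum>i\<in>UNIV. measure \<nu> (?J \<inter> tail_path -` cyl w \<inter> {\<omega>. \<omega> 0 = i}))"
      by (rule measure_split_coordinate[OF \<nu>'])
    also have "\<dots> = (\<Sum>i\<in>UNIV. if i \<in> J then measure \<nu> (cyl (i # w)) else 0)"
    proof (rule sum.cong[OF refl])
      fix i
      have "?J \<inter> tail_path -` cyl w \<inter> {\<omega>. \<omega> 0 = i} = (if i \<in> J then cyl (i # w) else {})"
        by (auto simp: cyl_Cons)
      then show "measure \<nu> (?J \<inter> tail_path -` cyl w \<inter> {\<omega>. \<omega> 0 = i})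
          = (if i \<in> J then measure \<nu> (cyl (i # w)) else 0)"
        by simp
    qed
    finally show ?thesis .
  qed
  show ?thesis
    unfolding central_measures_iff
  proof (intro conjI allI impI)
    show "conditioned_tail \<nu> J \<in> borel_probs"
      by (rule conditioned_tail_borel_probs[OF \<nu>' pos])
    fix u v assume uv: "length u = length v" "word_sum s u = word_sum s v"
    have "measure \<nu> (cyl (i # u)) = measure \<nu> (cyl (i # v))" for i
      using \<nu> uv unfolding central_measures_iff by simp
    then show "measure (conditioned_tail \<nu> J) (cyl u) = measure (conditioned_tail \<nu> J) (cyl v)"
      by (simp only: measure_conditioned_tail[OF \<nu>' pos cyl_borel] *)
  qed
qed

lemma absolute_unique:
  assumes "\<nu> \<in> absolute s" "\<mu> \<in> central_measures s" "\<eta> \<in> central_measures s"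
    and "0 < t" "t < 1"
    and "\<forall>A\<in>sets borel. measure \<nu> A = (1 - t) * measure \<mu> A + t * measure \<eta> A"
  shows "\<mu> = \<eta>"
  using assms unfolding absolute_def mem_Collect_eq by metis

text \<open>By tail invariance \<open>\<nu>\<close> is the mixture of its tails conditioned on
  \<open>i\<close> and on the remaining marks. Extremality makes the two equal, so the tail does not
  depend on whether the first mark is \<open>i\<close>.\<close>

lemma ergodic_Cons:
  fixes s :: "'i::{finite, discrete_topology} \<Rightarrow> 'a::ab_semigroup_add"
  assumes "\<nu> \<in> absolute s"
  shows "measure \<nu> (cyl (i # w)) = measure \<nu> (cyl [i]) * measure \<nu> (cyl w)"
proof -
  have \<nu>: "\<nu> \<in> central_measures s"
    using assms by (simp add: absolute_def)
  then have \<nu>': "\<nu> \<in> borel_probs"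
    by (simp add: central_measures_iff)
  then interpret prob_space \<nu> by (rule prob_space_borel_probs)
  have sets: "sets \<nu> = sets borel" and space: "space \<nu> = UNIV"
    by (rule sets_borel_probs[OF \<nu>'], rule space_borel_probs[OF \<nu>'])
  let ?E = "{\<omega> :: nat \<Rightarrow> 'i. \<omega> 0 \<in> {i}}" and ?F = "{\<omega> :: nat \<Rightarrow> 'i. \<omega> 0 \<in> - {i}}"
  define p where "p = measure \<nu> ?E"
  have cyl_i: "cyl [i] = ?E" and cyl_iw: "cyl (i # w) = ?E \<inter> tail_path -` cyl w" for w
    by (auto simp: cyl_Cons)
  have cyl_p: "measure \<nu> (cyl [i]) = p"
    by (simp only: cyl_i p_def)
  have E: "?E \<in> events" "?F \<in> events"
    by (simp_all only: sets initial_borel)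
  have F: "measure \<nu> ?F = 1 - p"
  proof -
    have "?F = space \<nu> - ?E" by (auto simp: space)
    then show ?thesis using prob_compl[OF E(1)] by (simp add: p_def)
  qed
  have split: "measure \<nu> A = measure \<nu> (?E \<inter> tail_path -` A) + measure \<nu> (?F \<inter> tail_path -` A)"
    if "A \<in> sets borel" for A
  proof -
    have meas: "tail_path -` A \<in> events"
      unfolding sets using measurable_sets[OF tail_path_borel that] by simp
    have "measure \<nu> A = measure \<nu> (tail_path -` A)"
      by (rule central_tail_invariant[OF \<nu> that, symmetric])
    also have "tail_path -` A = (?E \<inter> tail_path -` A) \<union> (?F \<inter> tail_path -` A)"
      by auto
    also have "measure \<nu> \<dots> = measure \<nu> (?E \<inter> tail_path -` A) + measure \<nu> (?F \<inter> tail_path -` A)"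
      using E meas by (intro finite_measure_Union) auto
    finally show ?thesis .
  qed
  \<comment> \<open>Conditioning requires both events to have positive measure; the two boundary
    cases are checked directly.\<close>
  consider "p = 0" | "p = 1" | "0 < p" "p < 1"
    using prob_le_1[of ?E] measure_nonneg[of \<nu> ?E] unfolding p_def by linarith
  then show ?thesis
  proof cases
    case 1
    have "measure \<nu> (cyl (i # w)) \<le> p"
      unfolding cyl_iw p_def using E by (intro finite_measure_mono) auto
    with 1 show ?thesis
      using measure_nonneg[of \<nu> "cyl (i # w)"] unfolding cyl_p by simp
  next
    case 2
    have "measure \<nu> (?F \<inter> tail_path -` cyl w) \<le> measure \<nu> ?F"
      using E by (intro finite_measure_mono) auto
    then have "measure \<nu> (?F \<inter> tail_path -` cyl w) = 0"
      using 2 F measure_nonneg[of \<nu> "?F \<inter> tail_path -` cyl w"] by linarith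
    with split[OF cyl_borel, of w] 2 show ?thesis
      unfolding cyl_p unfolding cyl_iw by simp
  next
    case 3
    have pos: "measure \<nu> ?E \<noteq> 0" "measure \<nu> ?F \<noteq> 0"
      using 3 unfolding F by (simp_all only: flip: p_def)
    let ?\<mu> = "conditioned_tail \<nu> {i}" and ?\<eta> = "conditioned_tail \<nu> (- {i})"
    have \<mu>: "measure ?\<mu> A = measure \<nu> (?E \<inter> tail_path -` A) / p"
      and \<eta>: "measure ?\<eta> A = measure \<nu> (?F \<inter> tail_path -` A) / (1 - p)" if "A \<in> sets borel" for A
      using measure_conditioned_tail[OF \<nu>' pos(1) that] measure_conditioned_tail[OF \<nu>' pos(2) that] F
      by (simp_all only: p_def)
    \<comment> \<open>The weight \<open>t\<close> is \<open>1 - p\<close>, the mass of the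
      complementary event, in the shape demanded by \<open>absolute\<close>.\<close>
    have "measure \<nu> A = (1 - (1 - p)) * measure ?\<mu> A + (1 - p) * measure ?\<eta> A"
      if "A \<in> sets borel" for A
      using split[OF that] 3 by (simp add: \<mu>[OF that] \<eta>[OF that])
    then have "\<forall>A\<in>sets borel. measure \<nu> A = (1 - (1 - p)) * measure ?\<mu> A + (1 - p) * measure ?\<eta> A"
      by (rule ballI)
    moreover have "0 < 1 - p" "1 - p < 1"
      using 3 by auto
    ultimately have "?\<mu> = ?\<eta>"
      using absolute_unique[OF assms conditioned_tail_central[OF \<nu> pos(1)]
          conditioned_tail_central[OF \<nu> pos(2)]] by (simp only:)
    then have "measure \<nu> (?F \<inter> tail_path -` cyl w) / (1 - p) = measure \<nu> (?E \<inter> tail_path -` cyl w) / p"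
      using \<mu>[OF cyl_borel, of w] \<eta>[OF cyl_borel, of w] by simp
    then have "measure \<nu> (?F \<inter> tail_path -` cyl w) * p = measure \<nu> (?E \<inter> tail_path -` cyl w) * (1 - p)"
      using 3 by (simp add: field_simps)
    with split[OF cyl_borel, of w] show ?thesis
      unfolding cyl_p unfolding cyl_iw by (simp add: algebra_simps)
  qed
qed

lemma marginal_prob_vector:
  fixes \<nu> :: "(nat \<Rightarrow> 'i::{finite, discrete_topology}) measure"
  assumes "\<nu> \<in> borel_probs"
  shows "(\<lambda>i. measure \<nu> (cyl [i])) \<in> prob_vectors"
proof -
  interpret prob_space \<nu> by (rule prob_space_borel_probs[OF assms(1)])
  have "measure \<nu> (cyl []) = 1"
    using prob_space space_borel_probs[OF assms] by simp
  then show ?thesis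
    using measure_cyl_snoc[OF assms, of "[]"] unfolding prob_vectors_def by simp
qed

lemma ergodic_imp_bernoulli:
  fixes s :: "'i::{finite, discrete_topology} \<Rightarrow> 'a::ab_semigroup_add"
  assumes "\<nu> \<in> absolute s"
  defines "p \<equiv> \<lambda>i. measure \<nu> (cyl [i])"
  shows "p \<in> central_vectors s" "\<nu> = bernoulli p"
proof -
  have central: "\<nu> \<in> central_measures s"
    using assms by (simp add: absolute_def)
  then have \<nu>: "\<nu> \<in> borel_probs"
    by (simp add: central_measures_iff)
  then interpret prob_space \<nu> by (rule prob_space_borel_probs)
  have p: "p \<in> prob_vectors"
    unfolding p_def by (rule marginal_prob_vector[OF \<nu>])
  have *: "measure \<nu> (cyl w) = word_prod p w" for w
  proof (induction w)
    case Nil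
    show ?case
      using prob_space space_borel_probs[OF \<nu>] by simp
  next
    case (Cons i w)
    then show ?case
      using ergodic_Cons[OF assms(1), of i w] by (simp add: p_def)
  qed
  show "p \<in> central_vectors s"
    using p central unfolding central_vectors_def central_measures_iff * by blast
  show "\<nu> = bernoulli p"
    by (rule borel_probs_eqI[OF \<nu> bernoulli_borel_probs]) (simp add: * measure_bernoulli_cyl[OF p])
qed

lemma bernoulli_central:
  fixes s :: "'i::{finite, discrete_topology} \<Rightarrow> 'a::ab_semigroup_add"
  assumes "p \<in> central_vectors s"
  shows "bernoulli p \<in> central_measures s"
  using assms
  unfolding central_vectors_def central_measures_iff mem_Collect_eq
  by (metis bernoulli_borel_probs measure_bernoulli_cyl)

section \<open>Second moments of marks and extremality of Bernoulli measures\<close>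

lemma sum_diagonal_const:
  "(\<Sum>k<N. \<Sum>l<N. if k = l then v else c) = real N * v + real N * (real N - 1) * (c :: real)"
proof -
  have "(\<Sum>l<N. if k = l then v else c) = v + (real N - 1) * c" if "k < N" for k
  proof -
    have "(\<Sum>l<N. if k = l then v else c) = (\<Sum>l<N. c + (if k = l then v - c else 0))"
      by (intro sum.cong) auto
    also have "\<dots> = real N * c + (v - c)"
      using that by (simp add: sum.distrib)
    finally show ?thesis
      by (simp add: algebra_simps)
  qed
  then have "(\<Sum>k<N. \<Sum>l<N. if k = l then v else c) = (\<Sum>k<N. v + (real N - 1) * c)"
    by (intro sum.cong) auto
  then show ?thesis
    by (simp add: algebra_simps)
qed

text \<open>The right side is the expectation of the square of \<open>(\<Sum>k<N. indicator (A k)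
  \<omega> - p) - a * indicator W \<omega>\<close>, multiplied out. The centre \<open>p\<close> is
  kept apart from the mean \<open>q\<close>, because the mean under a summand is unknown when this
  is applied; \<open>a\<close> is a free multiplier that tests the correlation with
  \<open>W\<close>.\<close>

lemma (in prob_space) exchangeable_second_moment:
  fixes A :: "nat \<Rightarrow> 'a set" and p a :: real
  assumes A: "\<And>k. A k \<in> events" and W: "W \<in> events"
    and q: "\<And>k. prob (A k) = q" and r: "\<And>k l. k < l \<Longrightarrow> prob (A k \<inter> A l) = r"
    and m: "\<And>k. prob (A k \<inter> W) = m"
  shows "0 \<le> real N * (q - 2 * p * q + p\<^sup>2) + real N * (real N - 1) * (r - 2 * p * q + p\<^sup>2)
    - 2 * a * (real N * (m - p * prob W)) + a\<^sup>2 * prob W"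
proof -
  define Y where "Y k \<omega> = indicator (A k) \<omega> - p" for k \<omega>
  define Z where "Z k \<omega> = Y k \<omega> * indicator W \<omega>" for k \<omega>
  have int_ind: "integrable M (indicator B :: 'a \<Rightarrow> real)" if "B \<in> events" for B
    using that by (simp add: integrable_real_indicator less_top[symmetric])
  have r': "prob (A k \<inter> A l) = (if k = l then q else r)" for k l
    using r[of k l] r[of l k] q[of k] by (cases k l rule: linorder_cases) (simp_all add: Int_commute)
  have YY_eq: "Y k \<omega> * Y l \<omega>
      = indicator (A k \<inter> A l) \<omega> - p * indicator (A k) \<omega> - p * indicator (A l) \<omega> + p\<^sup>2" for k l \<omega>
    by (simp add: Y_def indicator_inter_arith algebra_simps power2_eq_square)
  have Z_eq: "Z k \<omega> = indicator (A k \<inter> W) \<omega> - p * indicator W \<omega>" for k \<omega>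
    by (simp add: Z_def Y_def indicator_inter_arith algebra_simps)
  have AA: "A k \<inter> A l \<in> events" "A k \<inter> W \<in> events" for k l
    using A W by auto
  have int_YY: "integrable M (\<lambda>\<omega>. Y k \<omega> * Y l \<omega>)" for k l
    unfolding YY_eq using int_ind[OF AA(1)] int_ind[OF A] by simp
  have int_Z: "integrable M (Z k)" for k
    unfolding Z_eq[abs_def] using int_ind[OF AA(2)] int_ind[OF W] by simp
  have YY: "(\<integral>\<omega>. Y k \<omega> * Y l \<omega> \<partial>M) = (if k = l then q - 2 * p * q + p\<^sup>2 else r - 2 * p * q + p\<^sup>2)" for k l
    unfolding YY_eq using int_ind[OF AA(1)] int_ind[OF A]
    by (simp add: sets.Int_space_eq2 AA A r' q prob_space)
  have Z: "(\<integral>\<omega>. Z k \<omega> \<partial>M) = m - p * prob W" for k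
    unfolding Z_eq using int_ind[OF AA(2)] int_ind[OF W]
    by (simp add: sets.Int_space_eq2 AA W m)
  have "0 \<le> (\<integral>\<omega>. ((\<Sum>k<N. Y k \<omega>) - a * indicator W \<omega>)\<^sup>2 \<partial>M)"
    by simp
  also have "(\<lambda>\<omega>. ((\<Sum>k<N. Y k \<omega>) - a * indicator W \<omega>)\<^sup>2)
    = (\<lambda>\<omega>. (\<Sum>k<N. \<Sum>l<N. Y k \<omega> * Y l \<omega>) - 2 * a * (\<Sum>k<N. Z k \<omega>) + a\<^sup>2 * indicator W \<omega>)"
    (is "_ = ?g")
  proof
    fix \<omega>
    have "(indicator W \<omega> :: real)\<^sup>2 = indicator W \<omega>"
      by (simp split: split_indicator)
    then have "((\<Sum>k<N. Y k \<omega>) - a * indicator W \<omega>)\<^sup>2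
        = (\<Sum>k<N. Y k \<omega>) * (\<Sum>k<N. Y k \<omega>) - 2 * a * ((\<Sum>k<N. Y k \<omega>) * indicator W \<omega>) + a\<^sup>2 * indicator W \<omega>"
      by (simp add: power2_diff power2_eq_square[of "sum _ _"] power_mult_distrib)
    then show "((\<Sum>k<N. Y k \<omega>) - a * indicator W \<omega>)\<^sup>2 = ?g \<omega>"
      by (simp only: sum_product Z_def flip: sum_distrib_right)
  qed
  also have "(\<integral>\<omega>. ?g \<omega> \<partial>M)
    = (\<Sum>k<N. \<Sum>l<N. if k = l then q - 2 * p * q + p\<^sup>2 else r - 2 * p * q + p\<^sup>2)
      - 2 * a * (\<Sum>k<N. m - p * prob W) + a\<^sup>2 * prob W"
    using int_YY int_Z int_ind[OF W]
    by (simp add: YY Z sets.Int_space_eq2 W Bochner_Integration.integral_sum integrable_sum)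
  finally show ?thesis
    unfolding sum_diagonal_const by simp
qed

text \<open>For large \<open>N\<close> the term quadratic in \<open>N\<close> dominates.\<close>

lemma nonneg_if_quadratic_nonneg:
  fixes v c :: real
  assumes "\<And>N. 0 \<le> real N * v + real N * (real N - 1) * c"
  shows "0 \<le> c"
proof (rule ccontr)
  assume "\<not> 0 \<le> c"
  then have c: "c < 0" by simp
  obtain N :: nat where N: "v / - c + 1 < real N"
    using reals_Archimedean2 by blast
  have "v / - c < real (Suc N) - 1"
    using N by simp
  then have "v + (real (Suc N) - 1) * c < 0"
    using c by (simp add: field_simps)
  then have "real (Suc N) * (v + (real (Suc N) - 1) * c) < 0"
    by (intro mult_pos_neg) auto
  with assms[of "Suc N"] show False
    by (simp add: algebra_simps)
qed

text \<open>In effect Cauchy-Schwarz: a sum of \<open>N\<close> terms without correlations has size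
  of order \<open>sqrt N\<close>, so its pairing \<open>N * d\<close> with a fixed event cannot grow
  linearly.\<close>

lemma zero_if_quadratic_nonneg:
  fixes v d w :: real
  assumes "\<And>N a. 0 \<le> real N * v - 2 * a * (real N * d) + a\<^sup>2 * w" "w \<le> 1"
  shows "d = 0"
proof (rule ccontr)
  assume d: "d \<noteq> 0"
  \<comment> \<open>This makes \<open>2 * a * d = v + 2\<close>. With
    \<open>a\<^sup>2 * w \<le> N\<close> the expression is at most
    \<open>N * v - N * (v + 2) + N\<close>, that is \<open>- N\<close>.\<close>
  define a where "a = (v + 2) / (2 * d)"
  obtain N :: nat where N: "a\<^sup>2 + 1 < real N"
    using reals_Archimedean2 by blast
  have "0 < real N"
    using N zero_le_power2[of a] by linarith
  have "0 \<le> real N * v - 2 * a * (real N * d) + a\<^sup>2 * w"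
    by (rule assms)
  also have "\<dots> \<le> real N * v - 2 * a * (real N * d) + real N * 1"
    using mult_left_mono[OF \<open>w \<le> 1\<close>, of "a\<^sup>2"] N by simp
  also have "2 * a * (real N * d) = real N * (v + 2)"
    using d by (simp add: a_def)
  finally show False
    using \<open>0 < real N\<close> by (simp add: algebra_simps)
qed

text \<open>Swapping an intermediate mark \<open>j\<close> with the mark \<open>i\<close> after it
  changes neither the length nor the sum of the word. Then \<open>j\<close> stands last and is
  summed out.\<close>

lemma central_coordinate_later:
  fixes s :: "'i::{finite, discrete_topology} \<Rightarrow> 'a::ab_semigroup_add"
  assumes \<mu>: "\<mu> \<in> central_measures s"
  shows "measure \<mu> (cyl w \<inter> {\<omega>. \<omega> (length w + k) = i}) = measure \<mu> (cyl (w @ [i]))"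
proof (induction k arbitrary: w)
  case 0
  show ?case
    by (simp add: cyl_snoc)
next
  case (Suc k)
  have \<mu>': "\<mu> \<in> borel_probs"
    using \<mu> by (simp add: central_measures_iff)
  let ?A = "{\<omega> :: nat \<Rightarrow> 'i. \<omega> (length w + Suc k) = i}"
  have "measure \<mu> (cyl w \<inter> ?A) = (\<Sum>j\<in>UNIV. measure \<mu> (cyl w \<inter> ?A \<inter> {\<omega>. \<omega> (length w) = j}))"
    by (rule measure_split_coordinate[OF \<mu>']) (intro sets.Int cyl_borel coordinate_borel)
  also have "\<dots> = (\<Sum>j\<in>UNIV. measure \<mu> (cyl (w @ [j]) \<inter> {\<omega>. \<omega> (length (w @ [j]) + k) = i}))"
    by (intro sum.cong refl arg_cong[of _ _ "measure \<mu>"]) (auto simp: cyl_snoc)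
  also have "\<dots> = (\<Sum>j\<in>UNIV. measure \<mu> (cyl ((w @ [j]) @ [i])))"
    by (simp only: Suc.IH)
  also have "\<dots> = (\<Sum>j\<in>UNIV. measure \<mu> (cyl ((w @ [i]) @ [j])))"
  proof (rule sum.cong[OF refl])
    fix j
    have "word_sum s ((w @ [j]) @ [i]) = word_sum s ((w @ [i]) @ [j])"
      by (simp only: word_sum_append option_add_ac)
    moreover have "length ((w @ [j]) @ [i]) = length ((w @ [i]) @ [j])"
      by simp
    ultimately show "measure \<mu> (cyl ((w @ [j]) @ [i])) = measure \<mu> (cyl ((w @ [i]) @ [j]))"
      using \<mu> unfolding central_measures_iff by blast
  qed
  also have "\<dots> = measure \<mu> (cyl (w @ [i]))"
    by (rule measure_cyl_snoc[OF \<mu>', symmetric])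
  finally show ?case .
qed

lemma central_shift_coordinates:
  fixes s :: "'i::{finite, discrete_topology} \<Rightarrow> 'a::ab_semigroup_add"
  assumes \<mu>: "\<mu> \<in> central_measures s"
  shows "measure \<mu> {\<omega>. \<omega> k = i \<and> \<omega> (l + k) = j} = measure \<mu> {\<omega>. \<omega> 0 = i \<and> \<omega> l = j}"
proof (induction k)
  case (Suc k)
  have "{\<omega> :: nat \<Rightarrow> 'i. \<omega> (Suc k) = i \<and> \<omega> (l + Suc k) = j} = tail_path -` {\<omega>. \<omega> k = i \<and> \<omega> (l + k) = j}"
    by (simp add: tail_path_def vimage_def)
  moreover have "{\<omega>. \<omega> k = i \<and> \<omega> (l + k) = j} \<in> sets borel"
  proof -
    have "{\<omega>. \<omega> k = i} \<inter> {\<omega>. \<omega> (l + k) = j} \<in> sets (borel :: (nat \<Rightarrow> 'i) measure)"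
      by (intro sets.Int coordinate_borel)
    then show ?thesis
      by (simp add: Collect_conj_eq)
  qed
  ultimately show ?case
    using central_tail_invariant[OF \<mu>] Suc by (simp only:)
qed simp

lemma central_second_moment:
  fixes s :: "'i::{finite, discrete_topology} \<Rightarrow> 'a::ab_semigroup_add"
  assumes \<mu>: "\<mu> \<in> central_measures s"
  shows "0 \<le> real N * (measure \<mu> (cyl [i]) - 2 * p * measure \<mu> (cyl [i]) + p\<^sup>2)
    + real N * (real N - 1) * (measure \<mu> (cyl [i, i]) - 2 * p * measure \<mu> (cyl [i]) + p\<^sup>2)
    - 2 * a * (real N * (measure \<mu> (cyl (w @ [i])) - p * measure \<mu> (cyl w))) + a\<^sup>2 * measure \<mu> (cyl w)"
proof -
  have \<mu>': "\<mu> \<in> borel_probs"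
    using \<mu> by (simp add: central_measures_iff)
  interpret prob_space \<mu> by (rule prob_space_borel_probs[OF \<mu>'])
  \<comment> \<open>The positions start at \<open>length w\<close>, just behind the prefix, so that
    every \<open>?A k \<inter> cyl w\<close> has the measure of
    \<open>cyl (w @ [i])\<close>.\<close>
  let ?A = "\<lambda>k. {\<omega> :: nat \<Rightarrow> 'i. \<omega> (length w + k) = i}"
  have cyl_i: "cyl [i] = {\<omega>. \<omega> 0 = i}"
    by (simp add: cyl_def)
  show ?thesis
  proof (rule exchangeable_second_moment[of ?A])
    show "?A k \<in> events" "cyl w \<in> events" for k
      unfolding sets_borel_probs[OF \<mu>'] by (rule coordinate_borel, rule cyl_borel)
    show "prob (?A k) = prob (cyl [i])" for k
      using central_shift_coordinates[OF \<mu>, of "length w + k" i 0 i] by (simp add: cyl_i)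
    show "prob (?A k \<inter> ?A l) = prob (cyl [i, i])" if "k < l" for k l
    proof -
      from less_imp_Suc_add[OF that] obtain d where l: "l = Suc (k + d)"
        by blast
      have "prob (?A k \<inter> ?A l) = prob {\<omega>. \<omega> (length w + k) = i \<and> \<omega> (Suc d + (length w + k)) = i}"
        by (simp add: l Collect_conj_eq ac_simps)
      also have "\<dots> = prob {\<omega>. \<omega> 0 = i \<and> \<omega> (Suc d) = i}"
        by (rule central_shift_coordinates[OF \<mu>])
      also have "\<dots> = prob (cyl [i] \<inter> {\<omega>. \<omega> (length [i] + d) = i})"
        by (simp add: cyl_i Collect_conj_eq)
      also have "\<dots> = prob (cyl [i, i])"
        unfolding central_coordinate_later[OF \<mu>] by simp
      finally show ?thesis .
    qed
    show "prob (?A k \<inter> cyl w) = prob (cyl (w @ [i]))" for k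
      using central_coordinate_later[OF \<mu>, of w k i] by (simp add: Int_commute)
  qed
qed

lemma central_convex_part_eq_bernoulli:
  fixes s :: "'i::{finite, discrete_topology} \<Rightarrow> 'a::ab_semigroup_add"
  assumes \<mu>: "\<mu> \<in> central_measures s" and \<eta>: "\<eta> \<in> central_measures s" and p: "p \<in> prob_vectors"
    and t: "0 < t" "t < 1"
    and mix: "\<And>w. word_prod p w = (1 - t) * measure \<mu> (cyl w) + t * measure \<eta> (cyl w)"
  shows "\<mu> = bernoulli p"
proof -
  have \<mu>': "\<mu> \<in> borel_probs"
    using \<mu> by (simp add: central_measures_iff)
  interpret prob_space \<mu> by (rule prob_space_borel_probs[OF \<mu>'])
  have step: "prob (cyl (w @ [i])) = p i * prob (cyl w)" for w i
  proof -
    \<comment> \<open>This is the mixed moment of the indicators of \<open>i\<close> at the first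
      two places, centred at \<open>p i\<close> and not at the mean under \<open>\<nu>\<close>.
      Hence it is affine in \<open>\<nu>\<close>, its mixture is the Bernoulli value 0, and as both
      summands have nonnegative moments the one of \<open>\<mu>\<close> vanishes.\<close>
    let ?c = "\<lambda>\<nu>. measure \<nu> (cyl [i, i]) - 2 * p i * measure \<nu> (cyl [i]) + (p i)\<^sup>2"
    have "0 \<le> ?c \<nu>" if "\<nu> \<in> central_measures s" for \<nu>
    proof (rule nonneg_if_quadratic_nonneg)
      show "0 \<le> real N * (measure \<nu> (cyl [i]) - 2 * p i * measure \<nu> (cyl [i]) + (p i)\<^sup>2)
          + real N * (real N - 1) * ?c \<nu>" for N
        using central_second_moment[OF that, of N i "p i" 0 "[]"]
        by (simp only: mult_zero_left mult_zero_right diff_zero zero_power2 add_0_right)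
    qed
    then have pos: "0 \<le> (1 - t) * ?c \<mu>" "0 \<le> t * ?c \<eta>"
      using \<mu> \<eta> t by simp_all
    have "(1 - t) * ?c \<mu> + t * ?c \<eta> = word_prod p [i, i] - 2 * p i * word_prod p [i] + (p i)\<^sup>2"
      unfolding mix by (simp add: algebra_simps)
    also have "\<dots> = 0"
      by (simp add: power2_eq_square)
    finally have "(1 - t) * ?c \<mu> = 0"
      using pos by linarith
    then have c: "?c \<mu> = 0"
      using t by simp
    \<comment> \<open>Since \<open>?c \<mu> = 0\<close>, the second moment grows only linearly in
      \<open>N\<close>. The case \<open>w = []\<close> yields that \<open>i\<close> has probability
      \<open>p i\<close> under \<open>\<mu>\<close>.\<close>
    have "prob (cyl (w @ [i])) - p i * prob (cyl w) = 0"
    proof (rule zero_if_quadratic_nonneg)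
      show "prob (cyl w) \<le> 1"
        by simp
      show "0 \<le> real N * (prob (cyl [i]) - 2 * p i * prob (cyl [i]) + (p i)\<^sup>2)
          - 2 * a * (real N * (prob (cyl (w @ [i])) - p i * prob (cyl w))) + a\<^sup>2 * prob (cyl w)" for N a
        using central_second_moment[OF \<mu>, of N i "p i" a w] unfolding c by (simp only: mult_zero_right add_0_right)
    qed
    then show ?thesis
      by simp
  qed
  have "prob (cyl w) = word_prod p w" for w
  proof (induction w rule: rev_induct)
    case Nil
    show ?case
      using prob_space space_borel_probs[OF \<mu>'] by simp
  next
    case (snoc i w)
    then show ?case
      by (simp add: step)
  qed
  then show ?thesis
    by (intro borel_probs_eqI[OF \<mu>' bernoulli_borel_probs]) (simp only: measure_bernoulli_cyl[OF p])
qed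

theorem absolute_eq_bernoulli:
  fixes s :: "'i::{finite, discrete_topology} \<Rightarrow> 'a::ab_semigroup_add"
  shows "absolute s = bernoulli ` central_vectors s"
proof (rule subset_antisym; rule subsetI)
  fix \<nu> assume "\<nu> \<in> absolute s"
  then show "\<nu> \<in> bernoulli ` central_vectors s"
    using ergodic_imp_bernoulli by blast
next
  fix \<nu> assume "\<nu> \<in> bernoulli ` central_vectors s"
  then obtain p where p: "p \<in> central_vectors s" and \<nu>: "\<nu> = bernoulli p"
    by blast
  have p': "p \<in> prob_vectors"
    using p by (simp add: central_vectors_def)
  have "\<mu> = \<eta>" if \<mu>: "\<mu> \<in> central_measures s" and \<eta>: "\<eta> \<in> central_measures s" and t: "0 < t" "t < 1"
    and mix: "\<forall>A\<in>sets borel. measure \<nu> A = (1 - t) * measure \<mu> A + t * measure \<eta> A" for \<mu> \<eta> and t :: real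
  proof -
    have mix': "word_prod p w = (1 - t) * measure \<mu> (cyl w) + t * measure \<eta> (cyl w)" for w
      using bspec[OF mix cyl_borel] unfolding \<nu> measure_bernoulli_cyl[OF p'] .
    have "\<mu> = bernoulli p"
      by (rule central_convex_part_eq_bernoulli[OF \<mu> \<eta> p' t mix'])
    moreover have "\<eta> = bernoulli p"
      by (rule central_convex_part_eq_bernoulli[OF \<eta> \<mu> p', of "1 - t"]) (use t mix' in auto)
    ultimately show ?thesis
      by simp
  qed
  then show "\<nu> \<in> absolute s"
    using bernoulli_central[OF p] unfolding absolute_def \<nu> by blast
qed

section \<open>The topology of the absolute\<close>

lemma compact_paths: "compact (UNIV :: (nat \<Rightarrow> 'i::{finite, discrete_topology}) set)"
proof -
  have "compactin (product_topology (\<lambda>_ :: nat. euclidean :: 'i topology) UNIV) (PiE UNIV (\<lambda>_. UNIV))"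
    unfolding compactin_PiE by (simp add: finite_imp_compact)
  then show ?thesis
    by (simp only: euclidean_product_topology compactin_euclidean_iff PiE_UNIV)
qed

text \<open>A Lebesgue number argument: by compactness finitely many cylinders, on each of which
  \<open>f\<close> stays within \<open>e / 2\<close> of a reference value, cover the path space;
  \<open>N\<close> is their greatest length.\<close>

lemma cylinder_uniformly_continuous:
  fixes f :: "(nat \<Rightarrow> 'i::{finite, discrete_topology}) \<Rightarrow> real"
  assumes f: "continuous_on UNIV f" and e: "0 < e"
  obtains N where "\<And>n \<omega> \<eta>. N \<le> n \<Longrightarrow> map \<omega> [0..<n] = map \<eta> [0..<n] \<Longrightarrow> \<bar>f \<omega> - f \<eta>\<bar> < e"
proof -
  have "\<exists>n. cyl (map \<omega> [0..<n]) \<subseteq> {\<eta>. \<bar>f \<eta> - f \<omega>\<bar> < e / 2}" for \<omega>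
  proof -
    have "open {\<eta>. \<bar>f \<eta> - f \<omega>\<bar> < e / 2}"
      by (intro open_Collect_less continuous_intros f)
    then show ?thesis
      using open_contains_cyl[of "{\<eta>. \<bar>f \<eta> - f \<omega>\<bar> < e / 2}" \<omega>] e by auto
  qed
  then obtain n where n: "\<And>\<omega>. cyl (map \<omega> [0..<n \<omega>]) \<subseteq> {\<eta>. \<bar>f \<eta> - f \<omega>\<bar> < e / 2}"
    by metis
  obtain C where C: "finite C" "UNIV \<subseteq> (\<Union>\<omega>\<in>C. cyl (map \<omega> [0..<n \<omega>]))"
  proof (rule compactE_image[OF compact_paths, of UNIV "\<lambda>\<omega>. cyl (map \<omega> [0..<n \<omega>])"])
    show "open (cyl (map \<omega> [0..<n \<omega>]))" for \<omega> :: "nat \<Rightarrow> 'i"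
      by (rule open_cyl)
    show "UNIV \<subseteq> (\<Union>\<omega>. cyl (map \<omega> [0..<n \<omega>]))"
      using mem_cyl_prefix by blast
  qed blast
  define N where "N = Max (insert 0 (n ` C))"
  show thesis
  proof (rule that[of N])
    fix m and \<omega> \<eta> :: "nat \<Rightarrow> 'i"
    assume m: "N \<le> m" and eq: "map \<omega> [0..<m] = map \<eta> [0..<m]"
    obtain \<xi> where \<xi>: "\<xi> \<in> C" "\<omega> \<in> cyl (map \<xi> [0..<n \<xi>])"
      using C(2) by blast
    have "n \<xi> \<le> N"
      unfolding N_def using C(1) \<xi>(1) by (intro Max_ge) auto
    then have "\<And>k. k < n \<xi> \<Longrightarrow> \<omega> k = \<eta> k"
      using eq m by (simp add: map_eq_conv)
    then have "\<eta> \<in> cyl (map \<xi> [0..<n \<xi>])"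
      using \<xi>(2) by (simp add: cyl_def)
    then have "\<bar>f \<omega> - f \<xi>\<bar> < e / 2" "\<bar>f \<eta> - f \<xi>\<bar> < e / 2"
      using n[of \<xi>] \<xi>(2) by auto
    then show "\<bar>f \<omega> - f \<eta>\<bar> < e"
      by linarith
  qed
qed

text \<open>A representative of \<open>cyl w\<close> at which test functions are evaluated; the
  marks behind \<open>w\<close> are filled with an arbitrary letter.\<close>

definition pad :: "'i list \<Rightarrow> nat \<Rightarrow> 'i" where
  "pad w k = (if k < length w then w ! k else undefined)"

lemma map_pad: "map (pad w) [0..<length w] = w"
  by (rule nth_equalityI) (simp_all add: pad_def)

text \<open>The sum is the integral of the step function \<open>g\<close>, which is constant on
  cylinders of length \<open>n\<close> and within \<open>e\<close> of \<open>f\<close> everywhere.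
  The bound is uniform in \<open>\<nu>\<close>.\<close>

lemma integral_cylinder_approx:
  fixes f :: "(nat \<Rightarrow> 'i::{finite, discrete_topology}) \<Rightarrow> real"
  assumes \<nu>: "\<nu> \<in> borel_probs" and f: "continuous_on UNIV f" "bounded (range f)"
    and close: "\<And>\<omega> \<eta>. map \<omega> [0..<n] = map \<eta> [0..<n] \<Longrightarrow> \<bar>f \<omega> - f \<eta>\<bar> \<le> e"
  shows "\<bar>(\<Sum>w | length w = n. f (pad w) * measure \<nu> (cyl w)) - (\<integral>\<omega>. f \<omega> \<partial>\<nu>)\<bar> \<le> e"
proof -
  interpret prob_space \<nu> by (rule prob_space_borel_probs[OF \<nu>])
  note sets = sets_borel_probs[OF \<nu>]
  define g where "g \<omega> = (\<Sum>w | length w = n. f (pad w) * indicator (cyl w) \<omega>)" for \<omega>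
  have int_ind: "integrable \<nu> (indicator (cyl w) :: _ \<Rightarrow> real)" for w
    using cyl_borel[of w] unfolding sets[symmetric]
    by (simp add: integrable_real_indicator less_top[symmetric])
  have int_f: "integrable \<nu> f"
  proof -
    obtain B where B: "\<And>\<omega>. \<bar>f \<omega>\<bar> \<le> B"
      using f(2) by (auto simp: bounded_iff)
    have "f \<in> borel_measurable \<nu>"
      by (subst measurable_cong_sets[OF sets refl]) (rule borel_measurable_continuous_onI[OF f(1)])
    then show ?thesis
      by (rule integrable_const_bound[where B=B, rotated]) (simp add: B)
  qed
  have int_g: "integrable \<nu> g"
    unfolding g_def by (intro Bochner_Integration.integrable_sum integrable_mult_right int_ind)
  have "(\<integral>\<omega>. g \<omega> \<partial>\<nu>) = (\<Sum>w | length w = n. f (pad w) * measure \<nu> (cyl w))"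
    unfolding g_def
    by (simp add: Bochner_Integration.integral_sum integrable_mult_right int_ind space_borel_probs[OF \<nu>])
  moreover have "\<bar>(\<integral>\<omega>. g \<omega> \<partial>\<nu>) - (\<integral>\<omega>. f \<omega> \<partial>\<nu>)\<bar> \<le> e"
  proof -
    have g: "g \<omega> = f (pad (map \<omega> [0..<n]))" for \<omega>
    proof -
      have "g \<omega> = (\<Sum>w | length w = n. if map \<omega> [0..<n] = w then f (pad w) else 0)"
        unfolding g_def by (intro sum.cong refl) (simp add: indicator_def mem_cyl_iff)
      also have "\<dots> = f (pad (map \<omega> [0..<n]))"
        using finite_words[of n] by (subst sum.delta') auto
      finally show ?thesis .
    qed
    have gf: "\<bar>g \<omega> - f \<omega>\<bar> \<le> e" for \<omega>
      unfolding g using map_pad[of "map \<omega> [0..<n]"] by (intro close) simp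
    have "\<bar>(\<integral>\<omega>. g \<omega> \<partial>\<nu>) - (\<integral>\<omega>. f \<omega> \<partial>\<nu>)\<bar> = \<bar>\<integral>\<omega>. g \<omega> - f \<omega> \<partial>\<nu>\<bar>"
      by (subst Bochner_Integration.integral_diff[OF int_g int_f]) (rule refl)
    also have "\<dots> \<le> (\<integral>\<omega>. \<bar>g \<omega> - f \<omega>\<bar> \<partial>\<nu>)"
      by (rule integral_abs_bound)
    also have "\<dots> \<le> (\<integral>\<omega>. e \<partial>\<nu>)"
      by (intro integral_mono integrable_abs Bochner_Integration.integrable_diff int_g int_f) (simp_all add: gf)
    also have "\<dots> = e"
      by (simp add: prob_space)
    finally show ?thesis .
  qed
  ultimately show ?thesis
    by (simp only:)
qed

lemma continuous_on_word_prod [continuous_intros]: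
  "continuous_on S (\<lambda>p :: 'i \<Rightarrow> real. word_prod p w)"
proof (induction w)
  case (Cons i w)
  have "continuous_on S (\<lambda>p :: 'i \<Rightarrow> real. p i)"
    by (rule continuous_on_subset[OF continuous_on_product_coordinates]) simp
  with Cons show ?case
    by (simp add: continuous_on_mult)
qed simp

text \<open>The approximating sums are polynomials in \<open>p\<close> with an error uniform over
  \<open>prob_vectors\<close>, so the integral is a uniform limit of continuous functions.\<close>

lemma continuous_on_integral_bernoulli:
  fixes f :: "(nat \<Rightarrow> 'i::{finite, discrete_topology}) \<Rightarrow> real"
  assumes f: "continuous_on UNIV f" "bounded (range f)"
  shows "continuous_on prob_vectors (\<lambda>p. \<integral>\<omega>. f \<omega> \<partial>bernoulli p)"
proof (rule uniform_limit_theorem[where F=sequentially])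
  let ?P = "\<lambda>n p. \<Sum>w | length w = n. f (pad w) * word_prod p w"
  show "\<forall>\<^sub>F n in sequentially. continuous_on prob_vectors (?P n)"
    by (intro always_eventually allI continuous_intros)
  show "uniform_limit prob_vectors ?P (\<lambda>p. \<integral>\<omega>. f \<omega> \<partial>bernoulli p) sequentially"
  proof (rule uniform_limitI)
    fix e :: real assume "0 < e"
    then have "0 < e / 2" by simp
    then obtain N where N: "\<And>n \<omega> \<eta>. N \<le> n \<Longrightarrow> map \<omega> [0..<n] = map \<eta> [0..<n] \<Longrightarrow> \<bar>f \<omega> - f \<eta>\<bar> < e / 2"
      using cylinder_uniformly_continuous[OF f(1)] by metis
    show "\<forall>\<^sub>F n in sequentially. \<forall>p\<in>prob_vectors. dist (?P n p) (\<integral>\<omega>. f \<omega> \<partial>bernoulli p) < e"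
      unfolding eventually_sequentially
    proof (intro exI[of _ N] allI impI ballI)
      fix n and p :: "'i \<Rightarrow> real"
      assume n: "N \<le> n" and p: "p \<in> prob_vectors"
      have "\<bar>(\<Sum>w | length w = n. f (pad w) * measure (bernoulli p) (cyl w)) - (\<integral>\<omega>. f \<omega> \<partial>bernoulli p)\<bar> \<le> e / 2"
        by (rule integral_cylinder_approx[OF bernoulli_borel_probs f]) (rule less_imp_le[OF N[OF n]])
      then have "\<bar>?P n p - (\<integral>\<omega>. f \<omega> \<partial>bernoulli p)\<bar> \<le> e / 2"
        by (simp only: measure_bernoulli_cyl[OF p])
      then show "dist (?P n p) (\<integral>\<omega>. f \<omega> \<partial>bernoulli p) < e"
        using \<open>0 < e\<close> by (simp add: dist_real_def)
    qed
  qed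
qed simp

lemma topspace_weak_topology [simp]: "topspace weak_topology = (borel_probs :: 'b::topological_space measure set)"
proof -
  have "borel_probs \<in> {{\<nu> \<in> borel_probs. (\<integral>x. f x \<partial>\<nu>) \<in> U} | (f :: 'b \<Rightarrow> real) U.
        continuous_on UNIV f \<and> bounded (range f) \<and> open U}"
    by (rule CollectI, rule exI[of _ "\<lambda>_. 0"], rule exI[of _ UNIV]) simp
  then show ?thesis
    unfolding weak_topology_def topology_generated_by_topspace by blast
qed

lemma continuous_map_bernoulli:
  "continuous_map (top_of_set prob_vectors) weak_topology
    (bernoulli :: ('i::{finite, discrete_topology} \<Rightarrow> real) \<Rightarrow> _)"
  unfolding weak_topology_def
proof (rule continuous_on_generated_topo)
  show "bernoulli ` topspace (top_of_set prob_vectors)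
    \<subseteq> \<Union> {{\<nu> \<in> borel_probs. (\<integral>x. f x \<partial>\<nu>) \<in> U} | (f :: (nat \<Rightarrow> 'i) \<Rightarrow> real) U.
        continuous_on UNIV f \<and> bounded (range f) \<and> open U}"
    unfolding topology_generated_by_topspace[symmetric] weak_topology_def[symmetric]
      topspace_weak_topology
    using bernoulli_borel_probs by blast
  fix V :: "(nat \<Rightarrow> 'i) measure set"
  assume "V \<in> {{\<nu> \<in> borel_probs. (\<integral>x. f x \<partial>\<nu>) \<in> U} | (f :: (nat \<Rightarrow> 'i) \<Rightarrow> real) U.
        continuous_on UNIV f \<and> bounded (range f) \<and> open U}"
  then obtain f :: "(nat \<Rightarrow> 'i) \<Rightarrow> real" and U where V: "V = {\<nu> \<in> borel_probs. (\<integral>x. f x \<partial>\<nu>) \<in> U}"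
    and f: "continuous_on UNIV f" "bounded (range f)" and U: "open U"
    by blast
  have "openin (top_of_set prob_vectors) (prob_vectors \<inter> (\<lambda>p. \<integral>x. f x \<partial>bernoulli p) -` U)"
    by (rule continuous_openin_preimage_gen[OF continuous_on_integral_bernoulli[OF f] U])
  moreover have "prob_vectors \<inter> (\<lambda>p. \<integral>x. f x \<partial>bernoulli p) -` U
      = bernoulli -` V \<inter> topspace (top_of_set prob_vectors)"
    using bernoulli_borel_probs by (auto simp: V)
  ultimately show "openin (top_of_set prob_vectors) (bernoulli -` V \<inter> topspace (top_of_set prob_vectors))"
    by (simp only:)
qed

text \<open>One-letter cylinders are open and closed, so their indicators are bounded continuous
  test functions. The marginals provide the continuous inverse of \<open>bernoulli\<close>.\<close>

lemma continuous_map_marginal: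
  "continuous_map weak_topology euclidean
    (\<lambda>(\<nu> :: (nat \<Rightarrow> 'i::{finite, discrete_topology}) measure) i. measure \<nu> (cyl [i]))"
  unfolding euclidean_product_topology[symmetric] continuous_map_componentwise_UNIV
proof
  fix i :: 'i
  let ?f = "indicator (cyl [i]) :: _ \<Rightarrow> real"
  have "?f = (\<lambda>\<omega>. (\<lambda>j. if j = i then 1 else 0) (\<omega> 0))"
    by (auto simp: indicator_def cyl_def)
  moreover have "continuous_on UNIV (\<lambda>\<omega>. (\<lambda>j. if j = i then 1 else 0 :: real) (\<omega> (0 :: nat)))"
    by (rule continuous_on_compose2[OF Topological_Spaces.continuous_on_discrete
          continuous_on_product_coordinates subset_UNIV])
  ultimately have f: "continuous_on UNIV ?f"
    by (simp only:)
  have bdd: "bounded (range ?f)"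
    by (rule boundedI[of _ 1]) (auto simp: indicator_def)
  have eq: "measure \<nu> (cyl [i]) = (\<integral>\<omega>. ?f \<omega> \<partial>\<nu>)" if "\<nu> \<in> borel_probs" for \<nu>
    using space_borel_probs[OF that] by simp
  show "continuous_map weak_topology euclidean (\<lambda>\<nu>. measure \<nu> (cyl [i]))"
    unfolding continuous_map_def
  proof (intro conjI allI impI)
    fix U :: "real set" assume "openin euclidean U"
    then have "open U" by (simp only: open_openin)
    have "{\<nu> \<in> topspace weak_topology. measure \<nu> (cyl [i]) \<in> U} = {\<nu> \<in> borel_probs. (\<integral>\<omega>. ?f \<omega> \<partial>\<nu>) \<in> U}"
      unfolding topspace_weak_topology by (intro Collect_cong conj_cong refl) (simp only: eq)
    also have "openin weak_topology \<dots>"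
      unfolding weak_topology_def
      by (rule topology_generated_by_Basis, rule CollectI, rule exI[of _ ?f], rule exI[of _ U])
        (intro conjI refl f bdd \<open>open U\<close>)
    finally show "openin weak_topology {\<nu> \<in> topspace weak_topology. measure \<nu> (cyl [i]) \<in> U}" .
  qed simp
qed

lemma compact_central_vectors: "compact (central_vectors s)"
proof -
  have "compactin (product_topology (\<lambda>_. euclidean) UNIV) (PiE UNIV (\<lambda>_ :: 'a. {0..1 :: real}))"
    unfolding compactin_PiE by simp
  then have cube: "compact (PiE UNIV (\<lambda>_ :: 'a. {0..1 :: real}))"
    by (simp only: euclidean_product_topology compactin_euclidean_iff)
  have coord: "continuous_on UNIV (\<lambda>p :: 'a \<Rightarrow> real. p i)" for i
    by (rule continuous_on_product_coordinates)
  have "closed ({p. \<forall>i. 0 \<le> p i} \<inter> {p. (\<Sum>i\<in>UNIV. p i) = 1}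
      \<inter> (\<Inter>(u, v)\<in>{(u, v). length u = length v \<and> word_sum s u = word_sum s v}. {p. word_prod p u = word_prod p v}))"
    by (intro closed_Int closed_INT ballI closed_Collect_all closed_Collect_le closed_Collect_eq
        continuous_on_sum continuous_on_const coord)
      (auto intro!: closed_Collect_eq continuous_on_word_prod)
  also have "{p. \<forall>i. 0 \<le> p i} \<inter> {p. (\<Sum>i\<in>UNIV. p i) = 1}
      \<inter> (\<Inter>(u, v)\<in>{(u, v). length u = length v \<and> word_sum s u = word_sum s v}. {p. word_prod p u = word_prod p v})
      = central_vectors s"
    unfolding central_vectors_def prob_vectors_def by blast
  finally have "closed (central_vectors s)" .
  moreover have "central_vectors s \<subseteq> PiE UNIV (\<lambda>_. {0..1})"
  proof
    fix p assume "p \<in> central_vectors s"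
    then have p: "\<And>i. 0 \<le> p i" "sum p UNIV = 1"
      by (auto simp: central_vectors_def prob_vectors_def)
    have "p i \<le> 1" for i
      using member_le_sum[of i UNIV p] p by simp
    with p show "p \<in> PiE UNIV (\<lambda>_. {0..1})"
      by auto
  qed
  ultimately show ?thesis
    using compact_Int_closed[OF cube, of "central_vectors s"] by (simp add: Int_absorb1)
qed

theorem compactin_absolute:
  fixes s :: "'i::{finite, discrete_topology} \<Rightarrow> 'a::ab_semigroup_add"
  shows "compactin weak_topology (absolute s)"
proof -
  have "central_vectors s \<subseteq> prob_vectors"
    by (auto simp: central_vectors_def)
  then have "compactin (top_of_set prob_vectors) (central_vectors s)"
    using compact_central_vectors[of s] by (simp add: compactin_subtopology)
  then show ?thesis
    unfolding absolute_eq_bernoulli by (rule image_compactin[OF _ continuous_map_bernoulli])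
qed

section \<open>The main part and its positive parameters\<close>

definition positive_central_vectors :: "('i::finite \<Rightarrow> 'a::ab_semigroup_add) \<Rightarrow> ('i \<Rightarrow> real) set" where
  "positive_central_vectors s = {p \<in> central_vectors s. \<forall>i. 0 < p i}"

text \<open>Every word is the sequence of marks of a path, so nondegeneracy says that no
  \<open>word_prod p w\<close> vanishes, and one-letter words already force \<open>p\<close> to be
  positive.\<close>

lemma main_part_eq_bernoulli:
  fixes s :: "'i::{finite, discrete_topology} \<Rightarrow> 'a::ab_semigroup_add"
  shows "absolute_main_part s = bernoulli ` positive_central_vectors s"
proof -
  have "(\<forall>q v. path_to s q v \<longrightarrow> measure (bernoulli p) (cylinder q) \<noteq> 0) \<longleftrightarrow> (\<forall>i. 0 < p i)"
    if "p \<in> central_vectors s" for p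
  proof -
    have p: "p \<in> prob_vectors" and nonneg: "\<And>i. 0 \<le> p i"
      using that by (auto simp: central_vectors_def prob_vectors_def)
    have "(\<forall>q v. path_to s q v \<longrightarrow> measure (bernoulli p) (cylinder q) \<noteq> 0) \<longleftrightarrow> (\<forall>w. word_prod p w \<noteq> 0)"
      unfolding cylinder_eq_cyl measure_bernoulli_cyl[OF p]
      using path_to_iff[of s] by metis
    also have "\<dots> \<longleftrightarrow> (\<forall>i. 0 < p i)"
    proof
      assume *: "\<forall>w. word_prod p w \<noteq> 0"
      show "\<forall>i. 0 < p i"
      proof
        fix i
        show "0 < p i"
          using *[rule_format, of "[i]"] nonneg[of i] by simp
      qed
    next
      assume *: "\<forall>i. 0 < p i"
      have "0 < word_prod p w" for w
        by (induction w) (simp_all add: *)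
      then show "\<forall>w. word_prod p w \<noteq> 0"
        by (metis less_irrefl)
    qed
    finally show ?thesis .
  qed
  then show ?thesis
    unfolding absolute_main_part_def absolute_eq_bernoulli positive_central_vectors_def by blast
qed

theorem main_part_homeomorphic_positive_central_vectors:
  fixes s :: "'i::{finite, discrete_topology} \<Rightarrow> 'a::ab_semigroup_add"
  shows "subtopology weak_topology (absolute_main_part s)
    homeomorphic_space top_of_set (positive_central_vectors s)"
proof (rule homeomorphic_maps_imp_homeomorphic_space)
  let ?m = "\<lambda>(\<nu> :: (nat \<Rightarrow> 'i) measure) i. measure \<nu> (cyl [i])"
  have sub: "positive_central_vectors s \<subseteq> prob_vectors"
    by (auto simp: positive_central_vectors_def central_vectors_def)
  have inv: "?m (bernoulli p) = p" if "p \<in> positive_central_vectors s" for p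
    using that sub measure_bernoulli_cyl[of p] by (auto simp: fun_eq_iff)
  have "absolute_main_part s \<subseteq> borel_probs"
    unfolding main_part_eq_bernoulli using bernoulli_borel_probs by blast
  then have top: "topspace (subtopology weak_topology (absolute_main_part s)) = bernoulli ` positive_central_vectors s"
    by (simp add: main_part_eq_bernoulli Int_absorb1)
  show "homeomorphic_maps (subtopology weak_topology (absolute_main_part s))
      (top_of_set (positive_central_vectors s)) ?m bernoulli"
    unfolding homeomorphic_maps_def
  proof (intro conjI ballI)
    show "continuous_map (subtopology weak_topology (absolute_main_part s))
        (top_of_set (positive_central_vectors s)) ?m"
      unfolding continuous_map_in_subtopology top
      using continuous_map_from_subtopology[OF continuous_map_marginal] inv by auto
    have "continuous_map (top_of_set (positive_central_vectors s)) weak_topology bernoulli"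
      by (rule continuous_map_from_subtopology_mono[OF continuous_map_bernoulli sub])
    then show "continuous_map (top_of_set (positive_central_vectors s))
        (subtopology weak_topology (absolute_main_part s)) bernoulli"
      unfolding continuous_map_in_subtopology by (auto simp: main_part_eq_bernoulli)
    show "bernoulli (?m \<nu>) = \<nu>" if "\<nu> \<in> topspace (subtopology weak_topology (absolute_main_part s))" for \<nu>
      using that inv unfolding top by auto
    show "?m (bernoulli p) = p" if "p \<in> topspace (top_of_set (positive_central_vectors s))" for p
      using that inv by simp
  qed
qed

section \<open>Additive functions and the rank of the group of fractions\<close>

definition word_add :: "('i \<Rightarrow> real) \<Rightarrow> 'i list \<Rightarrow> real" where
  "word_add x w = sum_list (map x w)"

lemma word_add_simps [simp]:
  "word_add x [] = 0" "word_add x (i # w) = x i + word_add x w"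
  "word_add x (u @ v) = word_add x u + word_add x v"
  by (simp_all add: word_add_def)

text \<open>The restrictions to the generators of the additive functions from G to the reals, by
  \<open>additive_imp_additive_vector\<close> and \<open>additive_vector_extends\<close>; the space
  \<open>H\<close> of the overview.\<close>

definition additive_vectors :: "('i \<Rightarrow> 'a::ab_semigroup_add) \<Rightarrow> ('i \<Rightarrow> real) set" where
  "additive_vectors s =
     {x. \<forall>u v. word_sum s u = word_sum s v \<longrightarrow> word_add x u = word_add x v}"

lemma additive_vectorsD:
  "x \<in> additive_vectors s \<Longrightarrow> word_sum s u = word_sum s v \<Longrightarrow> word_add x u = word_add x v"
  unfolding additive_vectors_def by blast

lemma generated_imp_word_sum:
  "g \<in> generated_by (+) UNIV s \<Longrightarrow> \<exists>w. word_sum s w = Some g"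
proof (induction rule: generated_by.induct)
  case (single i)
  have "word_sum s [i] = Some (s i)"
    by simp
  then show ?case ..
next
  case (step x i)
  then obtain w where "word_sum s w = Some x"
    by blast
  then have "word_sum s (w @ [i]) = Some (x + s i)"
    by simp
  then show ?case ..
qed

lemma neutral_or_word_sum:
  assumes "system_of_generators UNIV (+) UNIV s"
  obtains "neutral UNIV (+) g" | w where "word_sum s w = Some g"
  using assms generated_imp_word_sum unfolding system_of_generators_def by blast

lemma additive_word_sum:
  fixes f :: "'a::ab_semigroup_add \<Rightarrow> real"
  assumes add: "\<And>a b. f (a + b) = f a + f b"
  shows "word_sum s w = Some g \<Longrightarrow> f g = word_add (\<lambda>i. f (s i)) w"
proof (induction w arbitrary: g)
  case (Cons i w)
  show ?case
  proof (cases "word_sum s w")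
    case None
    then have "w = []" by simp
    with Cons.prems show ?thesis by simp
  next
    case (Some h)
    then have "g = s i + h"
      using Cons.prems by simp
    then show ?thesis
      using Cons.IH[OF Some] by (simp add: add)
  qed
qed simp

lemma additive_imp_additive_vector:
  fixes f :: "'a::ab_semigroup_add \<Rightarrow> real"
  assumes add: "\<And>a b. f (a + b) = f a + f b"
  shows "(\<lambda>i. f (s i)) \<in> additive_vectors s"
  unfolding additive_vectors_def
proof (intro CollectI allI impI)
  fix u v assume uv: "word_sum s u = word_sum s v"
  show "word_add (\<lambda>i. f (s i)) u = word_add (\<lambda>i. f (s i)) v"
  proof (cases "word_sum s u")
    case None
    then have "u = []" "v = []"
      using uv by (metis word_sum_eq_None_iff)+
    then show ?thesis by simp
  next
    case (Some g)
    then show ?thesis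
      using additive_word_sum[of f, OF add] uv by metis
  qed
qed

lemma additive_vector_extends:
  assumes gen: "system_of_generators UNIV (+) UNIV s" and x: "x \<in> additive_vectors s"
  obtains f :: "'a::ab_semigroup_add \<Rightarrow> real"
  where "\<And>a b. f (a + b) = f a + f b" "\<And>i. f (s i) = x i"
proof
  \<comment> \<open>The default 0 is the right value at an identity that is not a sum of
    generators.\<close>
  define f where "f g = (if \<exists>w. word_sum s w = Some g
    then word_add x (SOME w. word_sum s w = Some g) else 0)" for g
  have f: "f g = word_add x w" if "word_sum s w = Some g" for g w
  proof -
    have "word_sum s (SOME w. word_sum s w = Some g) = Some g"
      by (rule someI[of "\<lambda>w. word_sum s w = Some g"]) (rule that)
    then have "word_add x (SOME w. word_sum s w = Some g) = word_add x w"
      using that by (intro additive_vectorsD[OF x]) simp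
    then show ?thesis
      using that unfolding f_def by auto
  qed
  have f_neutral: "f g = 0" if "neutral UNIV (+) g" for g
  proof (cases "\<exists>w. word_sum s w = Some g")
    case True
    then obtain w where w: "word_sum s w = Some g" by blast
    \<comment> \<open>An identity that is the sum of \<open>w\<close> is also the sum of
      \<open>w @ w\<close>, so its value equals its double.\<close>
    have "word_sum s (w @ w) = Some g"
      using that w by (simp add: neutral_def)
    then show ?thesis
      using f[OF w] f[of "w @ w" g] by simp
  qed (simp add: f_def)
  show "f (a + b) = f a + f b" for a b
  proof (cases rule: neutral_or_word_sum[OF gen, of a])
    case 1
    then have "a + b = b" by (simp add: neutral_def)
    then show ?thesis using f_neutral[OF 1] by simp
  next
    case (2 u)
    show ?thesis
    proof (cases rule: neutral_or_word_sum[OF gen, of b])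
      case 1
      then have "a + b = a" by (simp add: neutral_def)
      then show ?thesis using f_neutral[OF 1] by simp
    next
      case (2 v)
      have "word_sum s (u @ v) = Some (a + b)"
        using \<open>word_sum s u = Some a\<close> 2 by simp
      then show ?thesis
        using f[OF \<open>word_sum s u = Some a\<close>] f[OF 2] f[of "u @ v" "a + b"] by simp
    qed
  qed
  show "f (s i) = x i" for i
    using f[of "[i]" "s i"] by simp
qed

section \<open>From additive functions to linear functionals on the rationalised group of
  fractions\<close>

text \<open>G may have no identity to pair with \<open>a\<close>, hence the representative
  \<open>(a + a, a)\<close>.\<close>

lift_definition frac_of :: "'a::ab_semigroup_add \<Rightarrow> 'a fraction_group" is "\<lambda>a. (a + a, a)" .

lemma frac_of_add: "frac_of (a + b) = frac_of a + frac_of b"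
  by transfer (auto simp: fraction_rel_def ac_simps)

lemma frac_of_eq_iff: "frac_of a = frac_of b \<longleftrightarrow> (\<exists>k. a + k = b + k)"
proof (transfer, unfold fraction_rel_def, safe)
  fix a b k :: 'a
  assume "fst (a + a, a) + snd (b + b, b) + k = fst (b + b, b) + snd (a + a, a) + k"
  then have "a + (a + b + k) = b + (a + b + k)"
    by (simp add: ac_simps)
  then show "\<exists>k. a + k = b + k" ..
next
  fix a b k :: 'a
  assume "a + k = b + k"
  then have "(a + k) + (a + b) = (b + k) + (a + b)"
    by simp
  then show "\<exists>k. fst (a + a, a) + snd (b + b, b) + k = fst (b + b, b) + snd (a + a, a) + k"
    by (intro exI[of _ k]) (simp add: ac_simps)
qed

lemma fraction_group_cases:
  obtains a b where "z = frac_of a - frac_of (b :: 'a::ab_semigroup_add)"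
proof -
  have "\<exists>a b. z = frac_of a + - frac_of b"
  proof (transfer, clarify)
    fix a b :: 'a
    have "fraction_rel (a, b) (fst (a + a, a) + fst (snd (b + b, b), fst (b + b, b)),
        snd (a + a, a) + snd (snd (b + b, b), fst (b + b, b)))"
      by (auto simp: fraction_rel_def ac_simps)
    then show "\<exists>aa ba. fraction_rel (a, b) (fst (aa + aa, aa) + fst (snd (ba + ba, ba), fst (ba + ba, ba)),
        snd (aa + aa, aa) + snd (snd (ba + ba, ba), fst (ba + ba, ba)))"
      by blast
  qed
  then show thesis
    using that by auto
qed

lemma frac_of_neutral: "neutral UNIV (+) e \<Longrightarrow> frac_of e = 0"
  using frac_of_add[of e e] by (simp add: neutral_def)

text \<open>Equality of fractions involves an extra summand \<open>k\<close>, which cancels under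
  \<open>f\<close> in the reals. Thus \<open>f a - f b\<close> depends only on the fraction.\<close>

lemma additive_extends_to_fractions:
  fixes f :: "'a::ab_semigroup_add \<Rightarrow> real"
  assumes add: "\<And>a b. f (a + b) = f a + f b"
  obtains F where "\<And>y z. F (y + z) = F y + F z" "\<And>a. F (frac_of a) = f a"
proof
  have well_defined: "f a - f b = f c - f d" if "frac_of a - frac_of b = frac_of c - frac_of d" for a b c d
  proof -
    have "frac_of (a + d) = frac_of (c + b)"
      using that by (simp add: frac_of_add algebra_simps)
    then obtain k where "(a + d) + k = (c + b) + k"
      unfolding frac_of_eq_iff by blast
    then have "f ((a + d) + k) = f ((c + b) + k)"
      by (rule arg_cong)
    then show ?thesis
      by (simp add: add)
  qed
  define F where "F z = (SOME r. \<exists>a b. z = frac_of a - frac_of b \<and> r = f a - f b)" for z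
  have F: "F (frac_of a - frac_of b) = f a - f b" for a b
    unfolding F_def
  proof (rule some_equality)
    fix r assume "\<exists>c d. frac_of a - frac_of b = frac_of c - frac_of d \<and> r = f c - f d"
    then show "r = f a - f b"
      using well_defined by metis
  qed blast
  show "F (y + z) = F y + F z" for y z
  proof -
    obtain a b where y: "y = frac_of a - frac_of b" by (rule fraction_group_cases)
    obtain c d where z: "z = frac_of c - frac_of d" by (rule fraction_group_cases)
    have "y + z = frac_of (a + c) - frac_of (b + d)"
      by (simp add: y z frac_of_add)
    then show ?thesis
      using F[of "a + c" "b + d"] F[of a b] F[of c d] by (simp add: y z add)
  qed
  show "F (frac_of a) = f a" for a
    using F[of "a + a" a] by (simp add: frac_of_add add)
qed

lift_definition pure_tensor :: "'a::ab_group_add \<Rightarrow> 'b::ab_group_add \<Rightarrow> ('a, 'b) tensor"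
  is "\<lambda>a b. frag_of (a, b)" .

lemma pure_tensor_add_left: "pure_tensor (a + a') b = pure_tensor a b + pure_tensor a' b"
  by transfer (simp add: tensor_rel_def tensor_relations.left flip: diff_diff_add)

lemma pure_tensor_scale: "tensor_scale r (pure_tensor a q) = pure_tensor a (r * q)"
  by transfer (simp add: tensor_rel_def tensor_relations.zero)

lemma pure_tensor_zero_left [simp]: "pure_tensor 0 b = 0"
  using pure_tensor_add_left[of 0 0 b] by simp

lemma pure_tensor_diff_left: "pure_tensor (a - a') b = pure_tensor a b - pure_tensor a' b"
  using pure_tensor_add_left[of "a - a'" a' b] by simp

lemma abs_tensor_surj: "\<exists>z. t = abs_tensor z"
  by (rule tensor.abs_induct) blast

text \<open>Pure tensors generate the tensor product as a group, so closure under differences is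
  enough.\<close>

lemma tensor_induct [case_names pure diff]:
  fixes t :: "('a::ab_group_add, 'b::ab_group_add) tensor"
  assumes pure: "\<And>a b. P (pure_tensor a b)" and diff: "\<And>x y. P x \<Longrightarrow> P y \<Longrightarrow> P (x - y)"
  shows "P t"
proof -
  have "P (abs_tensor z)" for z :: "'a \<times> 'b \<Rightarrow>\<^sub>0 int"
    using subset_UNIV
  proof (induction z rule: frag_induction)
    case zero
    have "abs_tensor 0 = (pure_tensor 0 0 :: ('a, 'b) tensor) - pure_tensor 0 0"
      by (simp add: zero_tensor_def)
    then show ?case using diff pure by metis
  next
    case (one x)
    then show ?case using pure[of "fst x" "snd x"] by (simp add: pure_tensor.abs_eq)
  next
    case (diff x y)
    have "abs_tensor (x - y) = abs_tensor x - (abs_tensor y :: ('a, 'b) tensor)"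
      by (simp add: minus_tensor_def plus_tensor.abs_eq uminus_tensor.abs_eq)
    then show ?case using diff assms(2) by simp
  qed
  then show ?thesis
    by (rule tensor.abs_induct)
qed

lemma frag_additive_extension:
  fixes g :: "'k \<Rightarrow> real"
  obtains \<phi> :: "('k \<Rightarrow>\<^sub>0 int) \<Rightarrow> real"
  where "\<phi> 0 = 0" "\<And>x y. \<phi> (x - y) = \<phi> x - \<phi> y" "\<And>k. \<phi> (frag_of k) = g k"
proof
  define \<phi> where "\<phi> z = (\<Sum>k\<in>Poly_Mapping.keys z. of_int (Poly_Mapping.lookup z k) * g k)" for z
  have \<phi>: "\<phi> z = (\<Sum>k\<in>K. of_int (Poly_Mapping.lookup z k) * g k)"
    if "finite K" "Poly_Mapping.keys z \<subseteq> K" for z K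
    unfolding \<phi>_def by (rule sum.mono_neutral_left[OF that]) (auto simp: in_keys_iff)
  show "\<phi> 0 = 0"
    by (simp add: \<phi>_def)
  show "\<phi> (x - y) = \<phi> x - \<phi> y" for x y
  proof -
    let ?K = "Poly_Mapping.keys x \<union> Poly_Mapping.keys y"
    have "Poly_Mapping.keys (x - y) \<subseteq> ?K"
      by (auto simp: in_keys_iff lookup_minus)
    then have "\<phi> (x - y) = (\<Sum>k\<in>?K. of_int (Poly_Mapping.lookup (x - y) k) * g k)"
      by (intro \<phi>) auto
    also have "\<dots> = (\<Sum>k\<in>?K. of_int (Poly_Mapping.lookup x k) * g k)
        - (\<Sum>k\<in>?K. of_int (Poly_Mapping.lookup y k) * g k)"
      by (simp add: lookup_minus left_diff_distrib sum_subtractf)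
    also have "\<dots> = \<phi> x - \<phi> y"
      by (subst (1 2) \<phi>[of ?K]) auto
    finally show ?thesis .
  qed
  show "\<phi> (frag_of k) = g k" for k
    by (simp add: \<phi>_def)
qed

abbreviation rat_real_scale :: "rat \<Rightarrow> real \<Rightarrow> real" where
  "rat_real_scale q r \<equiv> of_rat q * r"

lemma vector_space_rat_real: "vector_space rat_real_scale"
  by unfold_locales (simp_all add: algebra_simps of_rat_add of_rat_mult)

text \<open>The rule sending the pure tensor of \<open>a\<close> and \<open>q\<close> to
  \<open>of_rat q * F a\<close> is additive in both arguments, hence kills
  \<open>tensor_relations\<close> and descends. The reals act as a rational vector space
  here.\<close>

lemma additive_extends_to_tensor:
  fixes F :: "'a::ab_group_add \<Rightarrow> real"
  assumes add: "\<And>y z. F (y + z) = F y + F z"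
  obtains T :: "('a, rat) tensor \<Rightarrow> real"
  where "Vector_Spaces.linear tensor_scale rat_real_scale T" "\<And>a. T (pure_tensor a 1) = F a"
proof -
  obtain \<phi> :: "('a \<times> rat \<Rightarrow>\<^sub>0 int) \<Rightarrow> real"
    where zero: "\<phi> 0 = 0" and diff: "\<And>x y. \<phi> (x - y) = \<phi> x - \<phi> y"
      and one: "\<And>k. \<phi> (frag_of k) = of_rat (snd k) * F (fst k)"
    using frag_additive_extension[of "\<lambda>k. of_rat (snd k) * F (fst k)"] by metis
  have plus: "\<phi> (x + y) = \<phi> x + \<phi> y" for x y
    using diff[of "x + y" y] by simp
  have rel: "\<phi> z = 0" if "z \<in> tensor_relations" for z
    using that
    by induction (simp_all add: zero diff plus one add of_rat_add algebra_simps)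
  define T where "T t = \<phi> (rep_tensor t)" for t
  have T: "T (abs_tensor z) = \<phi> z" for z
  proof -
    have "tensor_rel (rep_tensor (abs_tensor z)) z"
      using Quotient3_tensor equivp_tensor_rel
      by (metis Quotient3_abs_rep Quotient3_rel tensor.abs_eq_iff)
    then show ?thesis
      using rel[of "rep_tensor (abs_tensor z) - z"] by (simp add: T_def diff tensor_rel_def)
  qed
  have T_pure: "T (pure_tensor a q) = of_rat q * F a" for a q
    by (simp add: pure_tensor.abs_eq T one)
  have T_diff: "T (x - y) = T x - T y" for x y
  proof -
    obtain x' y' where xy: "x = abs_tensor x'" "y = abs_tensor y'"
      using abs_tensor_surj[of x] abs_tensor_surj[of y] by metis
    have "x - y = abs_tensor (x' - y')"
      by (simp add: xy minus_tensor_def plus_tensor.abs_eq uminus_tensor.abs_eq)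
    then show ?thesis
      by (simp add: xy T diff)
  qed
  have T_add: "T (x + y) = T x + T y" for x y
    using T_diff[of "x + y" y] by simp
  interpret V: vector_space "tensor_scale :: rat \<Rightarrow> ('a, rat) tensor \<Rightarrow> _"
    by (rule vector_space_tensor_scale)
  have T_scale: "T (tensor_scale r x) = of_rat r * T x" for r x
  proof (induction x rule: tensor_induct)
    case (pure a q)
    show ?case by (simp add: pure_tensor_scale T_pure of_rat_mult)
  next
    case (diff x y)
    then show ?case by (simp add: V.scale_right_diff_distrib T_diff right_diff_distrib)
  qed
  show thesis
  proof
    show "Vector_Spaces.linear tensor_scale rat_real_scale T"
      unfolding module_hom_iff_linear[symmetric] module_hom_def module_hom_axioms_def module_iff_vector_space
      using vector_space_tensor_scale vector_space_rat_real by (simp only: T_add T_scale) simp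
    show "T (pure_tensor a 1) = F a" for a
      by (simp add: T_pure)
  qed
qed

lemma additive_vector_tensor:
  fixes s :: "'i \<Rightarrow> 'a::ab_semigroup_add" and T :: "('a fraction_group, rat) tensor \<Rightarrow> real"
  assumes "Vector_Spaces.linear tensor_scale rat_real_scale T"
  shows "(\<lambda>i. T (pure_tensor (frac_of (s i)) 1)) \<in> additive_vectors s"
proof -
  interpret Vector_Spaces.linear tensor_scale rat_real_scale T
    by (rule assms)
  show ?thesis
    using additive_imp_additive_vector[of "\<lambda>a. T (pure_tensor (frac_of a) 1)" s]
    by (simp only: frac_of_add pure_tensor_add_left add)
qed

text \<open>Rational factors become scalars, fractions are differences of elements of G, and
  elements are sums of generators. An identity that is no such sum has class zero.\<close>

lemma span_pure_tensors:
  fixes s :: "'i \<Rightarrow> 'a::ab_semigroup_add"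
  assumes gen: "system_of_generators UNIV (+) UNIV s"
  shows "module.span tensor_scale (range (\<lambda>i. pure_tensor (frac_of (s i)) (1 :: rat))) = UNIV"
proof -
  interpret V: vector_space "tensor_scale :: rat \<Rightarrow> ('a fraction_group, rat) tensor \<Rightarrow> _"
    by (rule vector_space_tensor_scale)
  let ?G = "range (\<lambda>i. pure_tensor (frac_of (s i)) (1 :: rat))"
  have words: "word_sum s w = Some g \<Longrightarrow> pure_tensor (frac_of g) 1 \<in> V.span ?G" for w g
  proof (induction w arbitrary: g)
    case (Cons i w)
    have i: "pure_tensor (frac_of (s i)) 1 \<in> V.span ?G"
      by (rule V.span_base) blast
    show ?case
    proof (cases "word_sum s w")
      case None
      then have "w = []" by simp
      with Cons.prems i show ?thesis by simp
    next
      case (Some h)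
      then have "g = s i + h"
        using Cons.prems by simp
      then show ?thesis
        using V.span_add[OF i Cons.IH[OF Some]] by (simp add: frac_of_add pure_tensor_add_left)
    qed
  qed simp
  have sg: "pure_tensor (frac_of g) 1 \<in> V.span ?G" for g
  proof (cases rule: neutral_or_word_sum[OF gen, of g])
    case 1
    then show ?thesis
      using V.span_zero by (simp add: frac_of_neutral)
  next
    case (2 w)
    then show ?thesis by (rule words)
  qed
  have "t \<in> V.span ?G" for t
  proof (induction t rule: tensor_induct)
    case (pure z q)
    obtain a b where "z = frac_of a - frac_of b"
      by (rule fraction_group_cases)
    then have "pure_tensor z 1 \<in> V.span ?G"
      using V.span_diff[OF sg sg] by (simp add: pure_tensor_diff_left)
    then have "tensor_scale q (pure_tensor z 1) \<in> V.span ?G"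
      by (rule V.span_scale)
    then show ?case
      by (simp add: pure_tensor_scale)
  qed (rule V.span_diff)
  then show ?thesis
    by blast
qed

text \<open>
  Those \<open>e k\<close> are indices of generators whose classes form a basis of the rationalised group of
  fractions, and \<open>c\<close> is the matrix of coordinates of all generators.
\<close>

theorem additive_vectors_coordinates:
  fixes s :: "'i::finite \<Rightarrow> 'a::ab_semigroup_add"
  assumes gen: "system_of_generators UNIV (+) UNIV s"
  obtains c :: "'i \<Rightarrow> nat \<Rightarrow> real" and e :: "nat \<Rightarrow> 'i"
  where "\<forall>x\<in>additive_vectors s. \<forall>i. x i = (\<Sum>k<abelian_rank TYPE('a fraction_group). c i k * x (e k))"
    and "\<forall>y. (\<lambda>i. \<Sum>k<abelian_rank TYPE('a fraction_group). c i k * y k) \<in> additive_vectors s"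
    and "\<forall>l<abelian_rank TYPE('a fraction_group).
      \<forall>y. (\<Sum>k<abelian_rank TYPE('a fraction_group). c (e l) k * y k) = y l"
proof -
  interpret V: vector_space "tensor_scale :: rat \<Rightarrow> ('a fraction_group, rat) tensor \<Rightarrow> _"
    by (rule vector_space_tensor_scale)
  interpret VR: vector_space_pair "tensor_scale :: rat \<Rightarrow> ('a fraction_group, rat) tensor \<Rightarrow> _" rat_real_scale
    by (intro vector_space_pair.intro vector_space_tensor_scale vector_space_rat_real)
  let ?t = "\<lambda>i. pure_tensor (frac_of (s i)) (1 :: rat)"
  \<comment> \<open>The basis is drawn from the classes of the generators, so that the coordinates
    of \<open>x\<close> are its own values at the indices \<open>e k\<close>.\<close>
  obtain B where B: "B \<subseteq> range ?t" "V.independent B" "range ?t \<subseteq> V.span B"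
    by (rule V.maximal_independent_subset)
  have span: "V.span B = UNIV"
    using span_pure_tensors[OF gen] V.span_mono[OF B(3)] by (simp add: V.span_span top_le)
  have fin: "finite B"
    using B(1) by (rule finite_subset) simp
  define r where "r = abelian_rank TYPE('a fraction_group)"
  have r: "r = card B"
    unfolding r_def abelian_rank_def by (rule V.dim_eq_card) (simp_all add: span B(2))
  obtain h where h: "bij_betw h {..<r} B"
    using ex_bij_betw_nat_finite[OF fin] unfolding r atLeast0LessThan by blast
  define e where "e k = (SOME i. ?t i = h k)" for k
  have e: "?t (e k) = h k" if "k < r" for k
  proof -
    have "h k \<in> B"
      by (rule bij_betw_apply[OF h]) (simp add: that)
    then have "h k \<in> range ?t"
      by (rule subsetD[OF B(1)])
    then have "\<exists>i. ?t i = h k"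
      by (elim rangeE) (rule exI, erule sym)
    then show ?thesis
      unfolding e_def by (rule someI_ex)
  qed
  define c where "c i k = real_of_rat (V.representation B (?t i) (h k))" for i k
  have coords: "T (?t i) = (\<Sum>k<r. c i k * T (h k))"
    if "Vector_Spaces.linear tensor_scale rat_real_scale T" for T i
  proof -
    interpret T: Vector_Spaces.linear tensor_scale rat_real_scale T
      by (rule that)
    have "?t i = (\<Sum>b\<in>B. tensor_scale (V.representation B (?t i) b) b)"
      by (rule V.sum_representation_eq[symmetric]) (simp_all add: B(2) span fin)
    then have "T (?t i) = T (\<Sum>b\<in>B. tensor_scale (V.representation B (?t i) b) b)"
      by (rule arg_cong)
    also have "\<dots> = (\<Sum>b\<in>B. real_of_rat (V.representation B (?t i) b) * T b)"
      by (simp only: T.sum T.scale)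
    also have "\<dots> = (\<Sum>k<r. c i k * T (h k))"
      unfolding c_def by (rule sum.reindex_bij_betw[OF h, symmetric])
    finally show ?thesis .
  qed
  show thesis
  proof (rule that[of c e, folded r_def]; intro ballI allI impI)
    fix x i assume x: "x \<in> additive_vectors s"
    \<comment> \<open>\<open>x\<close> is extended in turn to G, to the group of fractions and to
      the tensor product, where \<open>coords\<close> applies.\<close>
    obtain f where f: "\<And>a b. f (a + b) = f a + f b" "\<And>i. f (s i) = x i"
      using additive_vector_extends[OF gen x] by metis
    obtain F where F: "\<And>y z. F (y + z) = F y + F z" "\<And>a. F (frac_of a) = f a"
      using additive_extends_to_fractions[of f, OF f(1)] by metis
    obtain T where T: "Vector_Spaces.linear tensor_scale rat_real_scale T" "\<And>a. T (pure_tensor a 1) = F a"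
      using additive_extends_to_tensor[of F, OF F(1)] by metis
    have Tt: "T (?t i) = x i" for i
      by (simp only: T(2) F(2) f(2))
    have "x i = (\<Sum>k<r. c i k * T (h k))"
      using coords[OF T(1), of i] by (simp only: Tt)
    also have "\<dots> = (\<Sum>k<r. c i k * x (e k))"
      by (intro sum.cong refl) (metis Tt e lessThan_iff)
    finally show "x i = (\<Sum>k<r. c i k * x (e k))" .
  next
    fix y :: "nat \<Rightarrow> real"
    \<comment> \<open>Independence over the rationals permits arbitrary real values on
      \<open>B\<close>, so every \<open>y\<close> occurs.\<close>
    obtain T where T: "Vector_Spaces.linear tensor_scale rat_real_scale T"
      and Th: "\<And>b. b \<in> B \<Longrightarrow> T b = y (the_inv_into {..<r} h b)"
      using VR.linear_independent_extend[OF B(2), of "\<lambda>b. y (the_inv_into {..<r} h b)"] by blast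
    have Thk: "T (h k) = y k" if "k < r" for k
      using that h by (subst Th) (auto simp: bij_betw_def the_inv_into_f_f)
    have Tt: "T (?t i) = (\<Sum>k<r. c i k * y k)" for i
      unfolding coords[OF T, of i] by (intro sum.cong refl) (simp add: Thk)
    show "(\<lambda>i. \<Sum>k<r. c i k * y k) \<in> additive_vectors s"
      using additive_vector_tensor[OF T, of s] by (simp only: Tt)
    show "(\<Sum>k<r. c (e l) k * y k) = y l" if "l < r" for l
      using Tt[of "e l"] by (simp only: e[OF that] Thk[OF that])
  qed
qed

section \<open>The main part in logarithmic coordinates\<close>

lemma continuous_on_coordinate [continuous_intros]:
  "continuous_on S (\<lambda>x :: 'i \<Rightarrow> 'b::topological_space. x i)"
  by (rule continuous_on_subset[OF continuous_on_product_coordinates]) simp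

lemma Euclidean_space_eq_top_of_set: "Euclidean_space d = top_of_set {x. \<forall>i\<ge>d. x i = 0}"
  by (simp only: Euclidean_space_def euclidean_product_topology)

lemma Euclidean_space_homeomorphic_open_disk: "Euclidean_space d homeomorphic_space open_disk d"
proof (rule homeomorphic_maps_imp_homeomorphic_space)
  let ?N = "\<lambda>x :: nat \<Rightarrow> real. \<Sum>i<d. (x i)\<^sup>2"
  let ?E = "{x :: nat \<Rightarrow> real. \<forall>i\<ge>d. x i = 0}"
  let ?D = "?E \<inter> {x. ?N x < 1}"
  let ?f = "\<lambda>x i. x i / sqrt (1 + ?N x)" and ?g = "\<lambda>x i. x i / sqrt (1 - ?N x)"
  have disk: "open_disk d = top_of_set ?D"
    unfolding open_disk_def Euclidean_space_eq_top_of_set subtopology_subtopology by (rule refl)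
  have pos: "0 < 1 + ?N x" for x
    by (intro add_pos_nonneg sum_nonneg) simp_all
  have N_f: "?N (?f x) = ?N x / (1 + ?N x)" for x
    using pos[of x] by (simp add: power_divide flip: sum_divide_distrib)
  have N_g: "?N (?g x) = ?N x / (1 - ?N x)" if "?N x < 1" for x
    using that by (simp add: power_divide flip: sum_divide_distrib)
  have gf: "?g (?f x) = x" for x
  proof
    fix i
    have "1 - ?N (?f x) = 1 / (1 + ?N x)"
      unfolding N_f using pos[of x] by (simp add: field_simps)
    then have "sqrt (1 - ?N (?f x)) = 1 / sqrt (1 + ?N x)"
      by (simp only: real_sqrt_divide real_sqrt_one)
    moreover have "sqrt (1 + ?N x) \<noteq> 0"
      using pos[of x] by simp
    ultimately show "?g (?f x) i = x i"
      by (simp only:) simp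
  qed
  have fg: "?f (?g x) = x" if "?N x < 1" for x
  proof
    fix i
    have "1 + ?N (?g x) = 1 / (1 - ?N x)"
      unfolding N_g[OF that] using that by (simp add: field_simps)
    then have "sqrt (1 + ?N (?g x)) = 1 / sqrt (1 - ?N x)"
      by (simp only: real_sqrt_divide real_sqrt_one)
    moreover have "sqrt (1 - ?N x) \<noteq> 0"
      using that by simp
    ultimately show "?f (?g x) i = x i"
      by (simp only:) simp
  qed
  have f_in: "?f x \<in> ?D" if "x \<in> ?E" for x
    using that pos[of x] by (simp add: N_f)
  have g_in: "?g x \<in> ?E" if "x \<in> ?D" for x
    using that by simp
  have cont_f: "continuous_on ?E ?f"
  proof (rule continuous_on_coordinatewise_then_product)
    fix i
    have "sqrt (1 + ?N x) \<noteq> 0" for x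
      using pos[of x] by simp
    then show "continuous_on ?E (\<lambda>x. ?f x i)"
      by (intro continuous_intros ballI)
  qed
  have cont_g: "continuous_on ?D ?g"
  proof (rule continuous_on_coordinatewise_then_product)
    fix i
    have "sqrt (1 - ?N x) \<noteq> 0" if "x \<in> ?D" for x
      using that by simp
    then show "continuous_on ?D (\<lambda>x. ?g x i)"
      by (intro continuous_intros ballI)
  qed
  show "homeomorphic_maps (Euclidean_space d) (open_disk d) ?f ?g"
    unfolding disk Euclidean_space_eq_top_of_set homeomorphic_maps_def
  proof (intro conjI ballI)
    show "continuous_map (top_of_set ?E) (top_of_set ?D) ?f"
      using cont_f f_in by (auto simp: continuous_map_in_subtopology)
    show "continuous_map (top_of_set ?D) (top_of_set ?E) ?g"
      using cont_g g_in by (auto simp: continuous_map_in_subtopology)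
  qed (use gf fg in auto)
qed

text \<open>
  Normalising by \<open>\<kappa>\<close> replaces the probability constraint, which is not linear in the
  logarithms, by a linear one.
\<close>

lemma positive_vectors_homeomorphic_Euclidean:
  fixes P L :: "('i::finite \<Rightarrow> real) set" and e :: "nat \<Rightarrow> 'i" and E :: "(nat \<Rightarrow> real) \<Rightarrow> 'i \<Rightarrow> real"
  assumes P: "\<And>p. p \<in> P \<longleftrightarrow> (\<forall>i. 0 < p i) \<and> sum p UNIV = 1 \<and> (\<lambda>i. ln (p i)) \<in> L"
    and L: "\<And>x t. x \<in> L \<Longrightarrow> (\<lambda>i. x i + t) \<in> L"
    and \<kappa>: "continuous_on UNIV \<kappa>" "\<And>x t. \<kappa> (\<lambda>i. x i + t) = \<kappa> x + t"
    and E: "continuous_on UNIV E" "\<And>y. E y \<in> L" "\<And>y. \<kappa> (E y) = 0" "\<And>y k. k < d \<Longrightarrow> E y (e k) = y k"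
      "\<And>x. x \<in> L \<Longrightarrow> \<kappa> x = 0 \<Longrightarrow> E (\<lambda>k. if k < d then x (e k) else 0) = x"
  shows "top_of_set P homeomorphic_space Euclidean_space d"
proof (rule homeomorphic_maps_imp_homeomorphic_space)
  let ?S = "{y :: nat \<Rightarrow> real. \<forall>k\<ge>d. y k = 0}"
  let ?ln = "\<lambda>p i. ln (p i :: real)"
  \<comment> \<open>The logarithm of \<open>p\<close> is shifted to have \<open>\<kappa> = 0\<close>
    and read off at the indices \<open>e k\<close>; the value is 0 from \<open>d\<close> on, as in
    \<open>Euclidean_space d\<close>.\<close>
  define f where "f p k = (if k < d then ln (p (e k)) - \<kappa> (?ln p) else 0)" for p k
  define Z where "Z y = (\<Sum>i\<in>UNIV. exp (E y i))" for y
  \<comment> \<open>Dividing by \<open>Z y\<close> restores total mass 1. On logarithms this is a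
    shift by a constant, which \<open>L\<close> absorbs.\<close>
  define g where "g y i = exp (E y i) / Z y" for y i
  have Z: "0 < Z y" for y
    unfolding Z_def by (intro sum_pos) auto
  have ln_g: "?ln (g y) = (\<lambda>i. E y i + - ln (Z y))" for y
    using Z[of y] by (simp add: g_def ln_div)
  have g_in: "g y \<in> P" for y
    unfolding P
  proof (intro conjI allI)
    show "0 < g y i" for i
      using Z[of y] by (simp add: g_def)
    have "sum (g y) UNIV = Z y / Z y"
      unfolding g_def by (subst sum_divide_distrib[symmetric]) (simp only: Z_def)
    then show "sum (g y) UNIV = 1"
      using Z[of y] by simp
    show "?ln (g y) \<in> L"
      unfolding ln_g by (rule L[OF E(2)])
  qed
  have fg: "f (g y) = y" if "y \<in> ?S" for y
  proof
    fix k
    have "\<kappa> (?ln (g y)) = - ln (Z y)"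
      unfolding ln_g \<kappa>(2) E(3) by simp
    moreover have "ln (g y (e k)) = E y (e k) + - ln (Z y)"
      using fun_cong[OF ln_g, of y "e k"] .
    ultimately show "f (g y) k = y k"
      using that E(4)[of k y] by (simp add: f_def)
  qed
  have gf: "g (f p) = p" if "p \<in> P" for p
  proof
    fix i
    let ?t = "\<kappa> (?ln p)"
    let ?x = "\<lambda>i. ln (p i) + - ?t"
    have p: "\<And>i. 0 < p i" "sum p UNIV = 1" "?ln p \<in> L"
      using that by (auto simp: P)
    have f_eq: "f p = (\<lambda>k. if k < d then ?x (e k) else 0)"
      by (auto simp: f_def)
    have Ef: "E (f p) = ?x"
      unfolding f_eq
    proof (rule E(5))
      show "?x \<in> L"
        by (rule L[OF p(3)])
      show "\<kappa> ?x = 0"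
        unfolding \<kappa>(2) by simp
    qed
    have exp: "exp (E (f p) i) = p i * exp (- ?t)" for i
      unfolding Ef by (simp only: exp_add exp_ln[OF p(1)])
    \<comment> \<open>As \<open>p\<close> sums to 1, the normalising factor undoes exactly the shift
      made in \<open>f\<close>.\<close>
    have "Z (f p) = exp (- ?t)"
      unfolding Z_def exp using p(2) by (simp flip: sum_distrib_right)
    then show "g (f p) i = p i"
      unfolding g_def exp by simp
  qed
  have cont_ln: "continuous_on P (\<lambda>p. ln (p i))" for i
  proof (rule continuous_on_ln[OF continuous_on_coordinate])
    show "\<forall>p\<in>P. p i \<noteq> 0"
    proof
      fix p assume "p \<in> P"
      then have "0 < p i"
        by (simp only: P)
      then show "p i \<noteq> 0"
        by simp
    qed
  qed
  have cont_f: "continuous_on P f"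
  proof (rule continuous_on_coordinatewise_then_product)
    fix k
    have "continuous_on P (\<lambda>p. \<kappa> (?ln p))"
      by (rule continuous_on_compose2[OF \<kappa>(1) continuous_on_coordinatewise_then_product[OF cont_ln]]) simp
    then have "continuous_on P (\<lambda>p. ln (p (e k)) - \<kappa> (?ln p))"
      by (intro continuous_on_diff cont_ln)
    then show "continuous_on P (\<lambda>p. f p k)"
      unfolding f_def by (cases "k < d") simp_all
  qed
  have cont_E: "continuous_on ?S (\<lambda>y. E y i)" for i
    by (rule continuous_on_product_then_coordinatewise[OF continuous_on_subset[OF E(1)]]) simp
  have cont_g: "continuous_on ?S g"
  proof (rule continuous_on_coordinatewise_then_product)
    fix i
    have "continuous_on ?S Z"
      unfolding Z_def by (intro continuous_on_sum continuous_on_exp cont_E)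
    then show "continuous_on ?S (\<lambda>y. g y i)"
      unfolding g_def using Z by (intro continuous_on_divide continuous_on_exp cont_E) (auto simp: less_le)
  qed
  show "homeomorphic_maps (top_of_set P) (Euclidean_space d) f g"
    unfolding Euclidean_space_eq_top_of_set homeomorphic_maps_def
  proof (intro conjI ballI)
    have "f p \<in> ?S" for p
      by (simp add: f_def)
    then show "continuous_map (top_of_set P) (top_of_set ?S) f"
      using cont_f by (auto simp: continuous_map_in_subtopology)
    show "continuous_map (top_of_set ?S) (top_of_set P) g"
      using cont_g g_in by (auto simp: continuous_map_in_subtopology)
  qed (use gf fg in auto)
qed

section \<open>Relations of unequal length and the dimension count\<close>

text \<open>The space \<open>L\<close> of the overview. Lengths are compared because centrality
  constrains only paths of equal length.\<close>

definition balanced_vectors :: "('i \<Rightarrow> 'a::ab_semigroup_add) \<Rightarrow> ('i \<Rightarrow> real) set" where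
  "balanced_vectors s = {x. \<forall>u v. length u = length v \<longrightarrow> word_sum s u = word_sum s v \<longrightarrow>
     word_add x u = word_add x v}"

lemma balanced_vectorsD:
  "x \<in> balanced_vectors s \<Longrightarrow> length u = length v \<Longrightarrow> word_sum s u = word_sum s v \<Longrightarrow>
    word_add x u = word_add x v"
  unfolding balanced_vectors_def by blast

lemma additive_subset_balanced: "additive_vectors s \<subseteq> balanced_vectors s"
  unfolding additive_vectors_def balanced_vectors_def by blast

lemma word_add_shift: "word_add (\<lambda>i. x i + t) w = word_add x w + t * real (length w)"
  by (induction w) (simp_all add: algebra_simps)

lemma balanced_vectors_shift:
  assumes "x \<in> balanced_vectors s"
  shows "(\<lambda>i. x i + t) \<in> balanced_vectors s"
  unfolding balanced_vectors_def
proof (intro CollectI allI impI)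
  fix u v :: "'a list" assume "length u = length v" "word_sum s u = word_sum s v"
  then show "word_add (\<lambda>i. x i + t) u = word_add (\<lambda>i. x i + t) v"
    unfolding word_add_shift using balanced_vectorsD[OF assms] by metis
qed

lemma word_prod_eq_exp:
  "(\<And>i. 0 < p i) \<Longrightarrow> word_prod p w = exp (word_add (\<lambda>i. ln (p i)) w)"
  by (induction w) (simp_all add: exp_add)

lemma positive_central_vectors_iff:
  "p \<in> positive_central_vectors s \<longleftrightarrow>
    (\<forall>i. 0 < p i) \<and> sum p UNIV = 1 \<and> (\<lambda>i. ln (p i)) \<in> balanced_vectors s"
proof (cases "\<forall>i. 0 < p i")
  case True
  then have "0 \<le> p i" for i
    by (simp add: less_imp_le)
  moreover have "word_prod p u = word_prod p v \<longleftrightarrow> word_add (\<lambda>i. ln (p i)) u = word_add (\<lambda>i. ln (p i)) v"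
    for u v using True by (simp add: word_prod_eq_exp)
  ultimately show ?thesis
    using True
    unfolding positive_central_vectors_def central_vectors_def prob_vectors_def balanced_vectors_def mem_Collect_eq
    by metis
qed (auto simp: positive_central_vectors_def)

lemma word_sum_concat_replicate:
  "word_sum s u = word_sum s v \<Longrightarrow> word_sum s (concat (replicate n u)) = word_sum s (concat (replicate n v))"
  by (induction n) simp_all

lemma word_add_concat_replicate: "word_add x (concat (replicate n u)) = real n * word_add x u"
  by (induction n) (simp_all add: algebra_simps)

text \<open>Both sides equal \<open>a * u - b * v\<close>. It equalises the word lengths in
  \<open>balanced_imp_additive\<close>.\<close>

lemma exchange_differences:
  assumes "b \<le> a" "v \<le> (u :: nat)"
  shows "(a - b) * u + (u - v) * b = (a - b) * v + (u - v) * a"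
proof -
  obtain i j where "a = b + i" "u = v + j"
    using assms le_Suc_ex by metis
  then show ?thesis
    by (simp add: algebra_simps)
qed

text \<open>A relation between \<open>u\<close> and \<open>v\<close> is corrected by one between
  \<open>a\<close> and \<open>b\<close>: \<open>?m\<close> copies of \<open>u\<close> with
  \<open>?n\<close> copies of \<open>b\<close> have the same sum and length as \<open>?m\<close>
  copies of \<open>v\<close> with \<open>?n\<close> copies of \<open>a\<close>. Since
  \<open>x\<close> agrees on \<open>a\<close> and \<open>b\<close>, their copies cancel, and
  \<open>?m\<close> is positive. The remaining orientations follow by symmetry.\<close>

lemma balanced_imp_additive:
  assumes x: "x \<in> balanced_vectors s"
    and u0v0: "word_sum s u0 = word_sum s v0" "length u0 \<noteq> length v0" "word_add x u0 = word_add x v0"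
  shows "x \<in> additive_vectors s"
proof -
  have *: "word_add x u = word_add x v"
    if uv: "word_sum s u = word_sum s v" "length v \<le> length u"
      and ab: "word_sum s a = word_sum s b" "length b < length a" "word_add x a = word_add x b" for u v a b
  proof -
    let ?m = "length a - length b" and ?n = "length u - length v"
    have len: "length (concat (replicate ?m u) @ concat (replicate ?n b))
        = length (concat (replicate ?m v) @ concat (replicate ?n a))"
      using exchange_differences[OF less_imp_le[OF ab(2)] uv(2)]
      by (simp only: length_append length_concat map_replicate sum_list_replicate of_nat_id)
    have "word_sum s (concat (replicate ?m u) @ concat (replicate ?n b))
        = word_sum s (concat (replicate ?m v) @ concat (replicate ?n a))"
      using word_sum_concat_replicate[OF uv(1), of ?m] word_sum_concat_replicate[OF ab(1), of ?n]
      by (simp only: word_sum_append)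
    from balanced_vectorsD[OF x len this]
    have "real ?m * word_add x u = real ?m * word_add x v"
      by (simp add: word_add_concat_replicate ab(3))
    then show ?thesis
      using ab(2) by simp
  qed
  have **: "word_add x u = word_add x v" if uv: "word_sum s u = word_sum s v" "length v \<le> length u" for u v
  proof (cases "length v0 < length u0")
    case True
    show ?thesis by (rule *[OF uv u0v0(1) True u0v0(3)])
  next
    case False
    then have "length u0 < length v0" using u0v0(2) by simp
    then show ?thesis by (rule *[OF uv u0v0(1)[symmetric] _ u0v0(3)[symmetric]])
  qed
  show ?thesis
    unfolding additive_vectors_def
  proof (intro CollectI allI impI)
    fix u v assume uv: "word_sum s u = word_sum s v"
    show "word_add x u = word_add x v"
    proof (cases "length v \<le> length u")
      case True
      show ?thesis by (rule **[OF uv True])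
    next
      case False
      then have "length u \<le> length v" by simp
      show ?thesis by (rule **[OF uv[symmetric] \<open>length u \<le> length v\<close>, symmetric])
    qed
  qed
qed

definition homogeneous :: "('i \<Rightarrow> 'a::ab_semigroup_add) \<Rightarrow> bool" where
  "homogeneous s \<longleftrightarrow> (\<forall>u v. word_sum s u = word_sum s v \<longrightarrow> length u = length v)"

lemma word_add_one: "word_add (\<lambda>_. 1) w = real (length w)"
  by (induction w) simp_all

text \<open>The vector of ones is the direction divided out by normalisation; whether it lies in
  \<open>H\<close> decides between the two dimensions.\<close>

lemma homogeneous_iff_one_additive: "homogeneous s \<longleftrightarrow> (\<lambda>_. 1) \<in> additive_vectors s"
  by (simp only: homogeneous_def additive_vectors_def word_add_one of_nat_eq_iff mem_Collect_eq)

theorem positive_central_vectors_homeomorphic_open_disk: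
  fixes s :: "'i::finite \<Rightarrow> 'a::ab_semigroup_add"
  assumes gen: "system_of_generators UNIV (+) UNIV s"
  shows "\<exists>d. (if homogeneous s then d + 1 = abelian_rank TYPE('a fraction_group)
      else d = abelian_rank TYPE('a fraction_group)) \<and>
    top_of_set (positive_central_vectors s) homeomorphic_space open_disk d"
proof -
  define r where "r = abelian_rank TYPE('a fraction_group)"
  obtain c :: "'i \<Rightarrow> nat \<Rightarrow> real" and e :: "nat \<Rightarrow> 'i"
    where "\<forall>x\<in>additive_vectors s. \<forall>i. x i = (\<Sum>k<r. c i k * x (e k))"
    and "\<forall>y. (\<lambda>i. \<Sum>k<r. c i k * y k) \<in> additive_vectors s"
    and "\<forall>l<r. \<forall>y. (\<Sum>k<r. c (e l) k * y k) = y l"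
    by (rule additive_vectors_coordinates[OF gen, folded r_def])
  note ec1 = this(1)[rule_format] and ec2 = this(2)[rule_format] and ec3 = this(3)[rule_format]
  \<comment> \<open>The additive vector with basis coordinates \<open>y k\<close> for
    \<open>k < d\<close> and zero from \<open>d\<close> on; \<open>d\<close> will be
    \<open>r - 1\<close> or \<open>r\<close>.\<close>
  define E where "E d y i = (\<Sum>k<r. c i k * (if k < d then y k else 0))" for d :: nat and y i
  have E_add: "E d y \<in> additive_vectors s" for d y
    unfolding E_def by (rule ec2)
  have E_e: "E d y (e l) = (if l < d then y l else 0)" if "l < r" for d y l
    unfolding E_def by (rule ec3[OF that])
  have E_cont: "continuous_on UNIV (E d)" for d
  proof (rule continuous_on_coordinatewise_then_product)
    fix i
    have "continuous_on UNIV (\<lambda>y. if k < d then y k else 0 :: real)" for k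
      by (cases "k < d") (simp_all add: continuous_on_coordinate)
    then show "continuous_on UNIV (\<lambda>y. E d y i)"
      unfolding E_def by (intro continuous_on_sum continuous_on_mult continuous_on_const)
  qed
  have homeo: "top_of_set (positive_central_vectors s) homeomorphic_space open_disk d"
    if d: "d \<le> r"
      and \<kappa>: "continuous_on UNIV \<kappa>" "\<And>x t. \<kappa> (\<lambda>i. x i + t) = \<kappa> x + t" "\<And>y. \<kappa> (E d y) = 0"
      and inv: "\<And>x. x \<in> balanced_vectors s \<Longrightarrow> \<kappa> x = 0 \<Longrightarrow> E d (\<lambda>k. if k < d then x (e k) else 0) = x"
    for d and \<kappa> :: "('i \<Rightarrow> real) \<Rightarrow> real"
  proof -
    have "top_of_set (positive_central_vectors s) homeomorphic_space Euclidean_space d"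
    proof (rule positive_vectors_homeomorphic_Euclidean[where L="balanced_vectors s" and \<kappa>=\<kappa> and E="E d" and e=e])
      show "E d y \<in> balanced_vectors s" for y
        using E_add additive_subset_balanced by blast
      show "E d y (e k) = y k" if "k < d" for y k
        using E_e[of k d y] that d by simp
    qed (rule positive_central_vectors_iff balanced_vectors_shift \<kappa> inv E_cont; assumption)+
    then show ?thesis
      by (rule homeomorphic_space_trans[OF _ Euclidean_space_homeomorphic_open_disk])
  qed
  show ?thesis
  proof (cases "homogeneous s")
    case True
    \<comment> \<open>For \<open>r = 0\<close> every additive vector is an empty sum, but the vector
      of ones is additive.\<close>
    have "r \<noteq> 0"
    proof
      assume "r = 0"
      moreover have "(1 :: real) = (\<Sum>k<r. c undefined k * 1)"
        using True by (intro ec1[of "\<lambda>_. 1"]) (simp only: homogeneous_iff_one_additive)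
      ultimately show False
        by simp
    qed
    then obtain d where d: "r = Suc d"
      by (cases r) auto
    have "top_of_set (positive_central_vectors s) homeomorphic_space open_disk d"
    \<comment> \<open>The freedom of adding constants is spent on making the last basis coordinate
      zero, which leaves \<open>d = r - 1\<close> of them.\<close>
    proof (rule homeo[where \<kappa>="\<lambda>x. x (e d)"])
      fix x assume x: "x \<in> balanced_vectors s" "x (e d) = 0"
      have "x \<in> additive_vectors s"
        using x(1) True unfolding homogeneous_def additive_vectors_def balanced_vectors_def by blast
      then have "x i = (\<Sum>k<r. c i k * x (e k))" for i
        by (rule ec1)
      also have "(\<Sum>k<r. c i k * x (e k)) = E d (\<lambda>k. if k < d then x (e k) else 0) i" for i
        unfolding E_def d using x(2) by (intro sum.cong refl) (auto simp: less_Suc_eq)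
      finally show "E d (\<lambda>k. if k < d then x (e k) else 0) = x"
        by (simp add: fun_eq_iff)
    next
      show "E d y (e d) = 0" for y
        using E_e[of d d y] d by simp
    qed (simp_all add: d continuous_on_coordinate)
    then show ?thesis
      using True d by (intro exI[of _ d]) (simp flip: r_def)
  next
    case False
    then obtain u v where uv: "word_sum s u = word_sum s v" "length u \<noteq> length v"
      unfolding homogeneous_def by blast
    define n where "n = real (length u) - real (length v)"
    have n: "n \<noteq> 0"
      using uv(2) by (simp add: n_def)
    have "top_of_set (positive_central_vectors s) homeomorphic_space open_disk r"
    \<comment> \<open>The defect of \<open>x\<close> on the relation between \<open>u\<close> and
      \<open>v\<close>. Division by \<open>n\<close> gives it the slope 1 along constants, and its
      zeros among balanced vectors are the additive ones.\<close>
    proof (rule homeo[where \<kappa>="\<lambda>x. (word_add x u - word_add x v) / n"])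
      have "continuous_on UNIV (\<lambda>x. word_add x w)" for w :: "'i list"
        by (induction w) (simp_all add: continuous_on_add continuous_on_coordinate)
      then show "continuous_on UNIV (\<lambda>x. (word_add x u - word_add x v) / n)"
        using n by (intro continuous_on_divide continuous_on_diff continuous_on_const) auto
      show "(word_add (\<lambda>i. x i + t) u - word_add (\<lambda>i. x i + t) v) / n
          = (word_add x u - word_add x v) / n + t" for x t
        using n unfolding word_add_shift by (simp add: n_def field_simps)
      show "(word_add (E r y) u - word_add (E r y) v) / n = 0" for y
        using additive_vectorsD[OF E_add uv(1), of r y] by simp
      fix x assume x: "x \<in> balanced_vectors s" "(word_add x u - word_add x v) / n = 0"
      have "x \<in> additive_vectors s"
        using x(2) n by (intro balanced_imp_additive[OF x(1) uv]) simp
      then have "x i = (\<Sum>k<r. c i k * x (e k))" for i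
        by (rule ec1)
      also have "(\<Sum>k<r. c i k * x (e k)) = E r (\<lambda>k. if k < r then x (e k) else 0) i" for i
        unfolding E_def by (intro sum.cong refl) auto
      finally show "E r (\<lambda>k. if k < r then x (e k) else 0) = x"
        by (simp add: fun_eq_iff)
    qed simp
    then show ?thesis
      using False by (intro exI[of _ r]) (simp add: r_def)
  qed
qed

section \<open>Branching semigroups\<close>

definition endpoint :: "('b, 'z) monoid_scheme \<Rightarrow> ('i \<Rightarrow> 'b) \<Rightarrow> 'i list \<Rightarrow> 'b" where
  "endpoint M t w = foldl (\<lambda>g i. mult M g (t i)) (one M) w"

lemma endpoint_Nil [simp]: "endpoint M t [] = one M"
  by (simp add: endpoint_def)

lemma endpoint_snoc: "endpoint M t (w @ [i]) = mult M (endpoint M t w) (t i)"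
  by (simp add: endpoint_def)

lemma (in monoid) endpoint_closed:
  "t ` I \<subseteq> carrier G \<Longrightarrow> set w \<subseteq> I \<Longrightarrow> endpoint G t w \<in> carrier G"
  by (induction w rule: rev_induct) (auto simp: endpoint_snoc)

lemma (in monoid) endpoint_append:
  assumes t: "t ` I \<subseteq> carrier G" and u: "set u \<subseteq> I"
  shows "set v \<subseteq> I \<Longrightarrow> endpoint G t (u @ v) = endpoint G t u \<otimes> endpoint G t v"
proof (induction v rule: rev_induct)
  case Nil
  show ?case
    using endpoint_closed[OF t u] by simp
next
  case (snoc i v)
  have "endpoint G t (u @ v) = endpoint G t u \<otimes> endpoint G t v"
    using snoc by simp
  moreover have "t i \<in> carrier G" "endpoint G t u \<in> carrier G" "endpoint G t v \<in> carrier G"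
    using t snoc.prems endpoint_closed[OF t u] endpoint_closed[OF t, of v] by auto
  ultimately show ?case
    using endpoint_snoc[of G t "u @ v" i] by (simp add: endpoint_snoc m_assoc)
qed

lemma (in monoid) endpoint_singleton: "t i \<in> carrier G \<Longrightarrow> endpoint G t [i] = t i"
  by (simp add: endpoint_def)

lemma (in monoid) endpoint_generated:
  assumes "t ` I \<subseteq> carrier G"
  shows "set w \<subseteq> I \<Longrightarrow> w \<noteq> [] \<Longrightarrow> endpoint G t w \<in> generated_by (mult G) I t"
proof (induction w rule: rev_induct)
  case (snoc i w)
  show ?case
  proof (cases "w = []")
    case True
    have "t i \<in> carrier G"
      using assms snoc.prems by auto
    with True show ?thesis
      using snoc.prems generated_by.single[of i I t] by (simp add: endpoint_singleton)
  next
    case False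
    then show ?thesis
      unfolding endpoint_snoc using snoc by (intro generated_by.step) auto
  qed
qed simp

text \<open>Walks from the identity are words by \<open>awalk_cayley_iff\<close>; this translation
  removes graphs from the argument.\<close>

lemma branching_cayley_iff:
  fixes M :: "'b monoid"
  assumes M: "monoid M" and t: "t ` I \<subseteq> carrier M"
  shows "branching_graph (cayley_graph M I t) (one M) \<longleftrightarrow>
    (\<forall>x\<in>carrier M. \<exists>w. set w \<subseteq> I \<and> x = endpoint M t w) \<and>
    (\<forall>u v. set u \<subseteq> I \<longrightarrow> set v \<subseteq> I \<longrightarrow> endpoint M t u = endpoint M t v \<longrightarrow> length u = length v)"
proof -
  interpret monoid M by (rule M)
  let ?walk = "pre_digraph.awalk (cayley_graph M I t) (one M)"
  have walk: "(\<exists>p. ?walk p v \<and> map snd p = w) \<longleftrightarrow> set w \<subseteq> I \<and> v = endpoint M t w" for v w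
    unfolding endpoint_def using t by (subst awalk_cayley_iff) auto
  have verts: "verts (cayley_graph M I t) = carrier M"
    by (simp add: cayley_graph_def)
  show ?thesis
    unfolding branching_graph_def verts
  proof (intro iffI conjI ballI allI impI)
    fix x assume *: "\<forall>v\<in>carrier M. (\<exists>p. ?walk p v) \<and>
      (\<forall>p q. ?walk p v \<longrightarrow> ?walk q v \<longrightarrow> length p = length q)" and "x \<in> carrier M"
    then obtain p where "?walk p x"
      by blast
    then show "\<exists>w. set w \<subseteq> I \<and> x = endpoint M t w"
      using walk[of x "map snd p"] by blast
  next
    fix u v assume *: "\<forall>v\<in>carrier M. (\<exists>p. ?walk p v) \<and>
        (\<forall>p q. ?walk p v \<longrightarrow> ?walk q v \<longrightarrow> length p = length q)"
      and uv: "set u \<subseteq> I" "set v \<subseteq> I" "endpoint M t u = endpoint M t v"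
    obtain p where p: "?walk p (endpoint M t u)" "map snd p = u"
      using walk[of "endpoint M t u" u] uv by blast
    obtain q where q: "?walk q (endpoint M t u)" "map snd q = v"
      using walk[of "endpoint M t u" v] uv by blast
    have "length p = length q"
      using * endpoint_closed[OF t uv(1)] p(1) q(1) by blast
    then show "length u = length v"
      using p(2) q(2) by auto
  next
    fix x assume *: "(\<forall>x\<in>carrier M. \<exists>w. set w \<subseteq> I \<and> x = endpoint M t w) \<and>
      (\<forall>u v. set u \<subseteq> I \<longrightarrow> set v \<subseteq> I \<longrightarrow> endpoint M t u = endpoint M t v \<longrightarrow> length u = length v)"
      and "x \<in> carrier M"
    then obtain w where "set w \<subseteq> I" "x = endpoint M t w"
      by blast
    then show "\<exists>p. ?walk p x"
      using walk[of x w] by blast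
  next
    fix x p q assume *: "(\<forall>x\<in>carrier M. \<exists>w. set w \<subseteq> I \<and> x = endpoint M t w) \<and>
      (\<forall>u v. set u \<subseteq> I \<longrightarrow> set v \<subseteq> I \<longrightarrow> endpoint M t u = endpoint M t v \<longrightarrow> length u = length v)"
      and pq: "?walk p x" "?walk q x"
    have "set (map snd p) \<subseteq> I \<and> x = endpoint M t (map snd p)"
      using walk[of x "map snd p"] pq(1) by blast
    moreover have "set (map snd q) \<subseteq> I \<and> x = endpoint M t (map snd q)"
      using walk[of x "map snd q"] pq(2) by blast
    ultimately have "length (map snd p) = length (map snd q)"
      using * by metis
    then show "length p = length q"
      by simp
  qed
qed

lemma branching_monoidI:
  fixes t :: "nat \<Rightarrow> 'b"
  assumes "comm_monoid M" "finite I" "I \<noteq> {}" "t ` I \<subseteq> carrier M"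
    and ex: "\<And>x. x \<in> carrier M \<Longrightarrow> \<exists>w. set w \<subseteq> I \<and> x = endpoint M t w"
    and len: "\<And>u v. set u \<subseteq> I \<Longrightarrow> set v \<subseteq> I \<Longrightarrow> endpoint M t u = endpoint M t v \<Longrightarrow> length u = length v"
  shows "branching_monoid M"
proof -
  interpret comm_monoid M by fact
  have "neutral (carrier M) (mult M) x \<or> x \<in> generated_by (mult M) I t" if x: "x \<in> carrier M" for x
  proof -
    obtain w where w: "set w \<subseteq> I" "x = endpoint M t w"
      using ex[OF x] by blast
    show ?thesis
    proof (cases "w = []")
      case True
      then show ?thesis
        using w by (simp add: neutral_def)
    next
      case False
      then show ?thesis
        using endpoint_generated[OF assms(4) w(1)] w(2) by simp
    qed
  qed
  then have gen: "system_of_generators (carrier M) (mult M) I t"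
    using assms(2-4) unfolding system_of_generators_def by (intro conjI ballI)
  have br: "branching_graph (cayley_graph M I t) (one M)"
    unfolding branching_cayley_iff[OF monoid_axioms assms(4)]
    by (intro conjI ballI allI impI ex len)
  show ?thesis
    unfolding branching_monoid_def by (intro conjI exI[of _ I] exI[of _ t] assms(1) gen br)
qed

text \<open>The common length of all words for an element is a grading. Concatenation makes it
  additive, only the empty word has length zero, and cutting off the last letter of a longer word
  splits an element into two non-identity factors.\<close>

lemma branching_monoid_length:
  assumes "branching_monoid M"
  shows "\<exists>l :: 'b \<Rightarrow> nat. (\<forall>x\<in>carrier M. \<forall>y\<in>carrier M. l (mult M x y) = l x + l y) \<and>
    (\<forall>x\<in>carrier M. l x = 0 \<longleftrightarrow> x = one M) \<and>
    (\<forall>x\<in>carrier M. 2 \<le> l x \<longrightarrow>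
      (\<exists>a\<in>carrier M - {one M}. \<exists>b\<in>carrier M - {one M}. x = mult M a b))"
proof -
  obtain I :: "nat set" and t where M: "comm_monoid M"
    and gen: "system_of_generators (carrier M) (mult M) I t"
    and br: "branching_graph (cayley_graph M I t) (one M)"
    using assms unfolding branching_monoid_def by blast
  interpret comm_monoid M by (rule M)
  have t: "t ` I \<subseteq> carrier M"
    using gen by (simp add: system_of_generators_def)
  have ex: "\<exists>w. set w \<subseteq> I \<and> x = endpoint M t w" if "x \<in> carrier M" for x
    using br that unfolding branching_cayley_iff[OF monoid_axioms t] by blast
  have len: "length u = length v"
    if "set u \<subseteq> I" "set v \<subseteq> I" "endpoint M t u = endpoint M t v" for u v
    using br that unfolding branching_cayley_iff[OF monoid_axioms t] by blast
  define l where "l x = length (SOME w. set w \<subseteq> I \<and> x = endpoint M t w)" for x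
  have l: "l (endpoint M t w) = length w" if w: "set w \<subseteq> I" for w
  proof -
    let ?P = "\<lambda>v. set v \<subseteq> I \<and> endpoint M t w = endpoint M t v"
    have "?P (SOME v. ?P v)"
      by (rule someI[of ?P w]) (simp add: w)
    then show ?thesis
      unfolding l_def using len[OF _ w] by metis
  qed
  show ?thesis
  proof (intro exI[of _ l] conjI ballI impI)
    fix x y assume x: "x \<in> carrier M" and y: "y \<in> carrier M"
    obtain u where u: "set u \<subseteq> I" "x = endpoint M t u"
      using ex[OF x] by blast
    obtain v where v: "set v \<subseteq> I" "y = endpoint M t v"
      using ex[OF y] by blast
    show "l (x \<otimes>\<^bsub>M\<^esub> y) = l x + l y"
      using l[of "u @ v"] l[OF u(1)] l[OF v(1)] u v endpoint_append[OF t u(1) v(1)] by simp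
  next
    fix x assume "x \<in> carrier M"
    then obtain w where w: "set w \<subseteq> I" "x = endpoint M t w"
      using ex by blast
    show "l x = 0 \<longleftrightarrow> x = \<one>\<^bsub>M\<^esub>"
      using l[OF w(1)] l[of "[]"] w(2) by auto
  next
    fix x assume "x \<in> carrier M" "2 \<le> l x"
    then obtain w where w: "set w \<subseteq> I" "x = endpoint M t w" "2 \<le> length w"
      using ex l by metis
    obtain v i where vi: "w = v @ [i]"
      using w(3) by (cases w rule: rev_cases) auto
    have v: "set v \<subseteq> I" "v \<noteq> []" and i: "set [i] \<subseteq> I"
      using w vi by auto
    have "endpoint M t v \<noteq> \<one>\<^bsub>M\<^esub>"
      using l[OF v(1)] l[of "[]"] v(2) by auto
    moreover have "endpoint M t [i] \<noteq> \<one>\<^bsub>M\<^esub>"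
      using l[OF i] l[of "[]"] by auto
    moreover have "x = endpoint M t v \<otimes>\<^bsub>M\<^esub> endpoint M t [i]"
      unfolding w(2) vi by (rule endpoint_append[OF t v(1) i])
    ultimately show "\<exists>a\<in>carrier M - {\<one>\<^bsub>M\<^esub>}. \<exists>b\<in>carrier M - {\<one>\<^bsub>M\<^esub>}. x = a \<otimes>\<^bsub>M\<^esub> b"
      using endpoint_closed[OF t v(1)] endpoint_closed[OF t i] by blast
  qed
qed

lemma neutral_unique:
  fixes a b :: "'a::ab_semigroup_add"
  shows "neutral UNIV (+) a \<Longrightarrow> neutral UNIV (+) b \<Longrightarrow> a = b"
  unfolding neutral_def by metis

text \<open>Degree zero belongs to the identity and degree at least two would split the element. If
  the identity of \<open>M\<close> was removed, the grading is pulled back along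
  \<open>\<phi>\<close>; being positive on all of G, it rules out an identity there.\<close>

lemma branching_irreducible_length:
  assumes "branching_semigroup TYPE('a::ab_semigroup_add)"
  obtains l :: "'a::ab_semigroup_add \<Rightarrow> nat"
  where "\<And>a b. l (a + b) = l a + l b" "\<And>x. x \<in> irreducible_elements \<Longrightarrow> l x = 1"
proof -
  consider (monoid) e :: 'a where "branching_monoid \<lparr>carrier = UNIV, mult = (+), one = e\<rparr>"
    | (punctured) M :: "'a option monoid" and \<phi> where "branching_monoid M"
      "bij_betw \<phi> (UNIV :: 'a set) (carrier M - {one M})" "\<And>a b. \<phi> (a + b) = mult M (\<phi> a) (\<phi> b)"
    using assms unfolding branching_semigroup_def by blast
  then show thesis
  proof cases
    case monoid
    let ?M = "\<lparr>carrier = UNIV, mult = (+), one = e\<rparr>"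
    have "comm_monoid ?M"
      using monoid by (simp add: branching_monoid_def)
    then have e: "neutral UNIV (+) e"
      using monoid.l_one[of ?M] monoid.r_one[of ?M] by (simp add: comm_monoid_def neutral_def)
    from branching_monoid_length[OF monoid, unfolded partial_object.simps monoid.simps ball_UNIV]
    obtain l :: "'a \<Rightarrow> nat" where l: "(\<forall>x y. l (x + y) = l x + l y) \<and> (\<forall>x. l x = 0 \<longleftrightarrow> x = e) \<and>
        (\<forall>x. 2 \<le> l x \<longrightarrow> (\<exists>a\<in>UNIV - {e}. \<exists>b\<in>UNIV - {e}. x = a + b))"
      by (rule exE)
    note add = l[THEN conjunct1, rule_format]
      and zero = l[THEN conjunct2, THEN conjunct1, rule_format]
      and split = l[THEN conjunct2, THEN conjunct2, rule_format]
    have "l x = 1" if x: "x \<in> irreducible_elements" for x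
    proof -
      have "x \<noteq> e"
        using x e by (auto simp: irreducible_elements_def)
      moreover have "\<not> 2 \<le> l x"
      proof
        assume "2 \<le> l x"
        then obtain a b where ab: "a \<noteq> e" "b \<noteq> e" "x = a + b"
          using split by blast
        then have "\<not> neutral UNIV (+) a" "\<not> neutral UNIV (+) b"
          using neutral_unique e by blast+
        then show False
          using x ab(3) unfolding irreducible_elements_def by blast
      qed
      ultimately show ?thesis
        using zero[of x] by linarith
    qed
    with add show thesis
      by (rule that)
  next
    case punctured
    from branching_monoid_length[OF punctured(1)]
    obtain l where l: "(\<forall>x\<in>carrier M. \<forall>y\<in>carrier M. l (mult M x y) = l x + l y) \<and>
        (\<forall>x\<in>carrier M. l x = (0 :: nat) \<longleftrightarrow> x = one M) \<and>
        (\<forall>x\<in>carrier M. 2 \<le> l x \<longrightarrow>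
          (\<exists>a\<in>carrier M - {one M}. \<exists>b\<in>carrier M - {one M}. x = mult M a b))"
      by (rule exE)
    note l_add = l[THEN conjunct1, rule_format]
      and l_zero = l[THEN conjunct2, THEN conjunct1, rule_format]
      and l_split = l[THEN conjunct2, THEN conjunct2, rule_format]
    have \<phi>: "\<phi> a \<in> carrier M" "\<phi> a \<noteq> one M" for a
      using bij_betw_apply[OF punctured(2), of a] by simp_all
    have add: "l (\<phi> (a + b)) = l (\<phi> a) + l (\<phi> b)" for a b
      unfolding punctured(3) by (rule l_add[OF \<phi>(1) \<phi>(1)])
    have pos: "l (\<phi> a) \<noteq> 0" for a
      using l_zero[OF \<phi>(1)] \<phi>(2) by simp
    have no_neutral: "\<not> neutral UNIV (+) a" for a :: 'a
    proof
      assume "neutral UNIV (+) a"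
      then have "l (\<phi> a) + l (\<phi> a) = l (\<phi> a)"
        using add[of a a] by (simp add: neutral_def)
      with pos[of a] show False by simp
    qed
    have "l (\<phi> x) = 1" if x: "x \<in> irreducible_elements" for x
    proof -
      have "\<not> 2 \<le> l (\<phi> x)"
      proof
        assume "2 \<le> l (\<phi> x)"
        then obtain a b where ab: "a \<in> carrier M - {one M}" "b \<in> carrier M - {one M}" "\<phi> x = mult M a b"
          using l_split[OF \<phi>(1)] by blast
        obtain a' b' where "a = \<phi> a'" "b = \<phi> b'"
          using ab(1,2) punctured(2) unfolding bij_betw_def by blast
        then have "\<phi> x = \<phi> (a' + b')"
          using ab(3) punctured(3) by simp
        then have "x = a' + b'"
          using punctured(2) unfolding bij_betw_def by (blast dest: injD)
        then show False
          using x no_neutral unfolding irreducible_elements_def by blast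
      qed
      then show ?thesis
        using pos[of x] by linarith
    qed
    with add show thesis
      by (rule that)
  qed
qed

text \<open>The grading is an additive function with value 1 at every generator, so the vector of
  ones is additive.\<close>

lemma branching_imp_homogeneous:
  fixes s :: "'i \<Rightarrow> 'a::ab_semigroup_add"
  assumes "branching_semigroup TYPE('a)" "admissible s"
  shows "homogeneous s"
proof -
  obtain l :: "'a \<Rightarrow> nat" where l: "\<And>a b. l (a + b) = l a + l b" "\<And>x. x \<in> irreducible_elements \<Longrightarrow> l x = 1"
    using branching_irreducible_length[OF assms(1)] by metis
  have "(\<lambda>i. real (l (s i))) \<in> additive_vectors s"
    by (rule additive_imp_additive_vector[of "\<lambda>a. real (l a)"]) (simp add: l(1))
  moreover have "l (s i) = 1" for i
    using assms(2) by (intro l(2)) (auto simp: admissible_def)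
  ultimately show ?thesis
    unfolding homogeneous_iff_one_additive by simp
qed

section \<open>Homogeneous systems of generators\<close>

lemma homogeneousD: "homogeneous s \<Longrightarrow> word_sum s u = word_sum s v \<Longrightarrow> length u = length v"
  unfolding homogeneous_def by blast

text \<open>Otherwise \<open>w\<close> and \<open>w @ w\<close> would have the same sum but
  different lengths.\<close>

lemma homogeneous_not_neutral:
  assumes "homogeneous s" "word_sum s w = Some g"
  shows "\<not> neutral UNIV (+) g"
proof
  assume "neutral UNIV (+) g"
  then have "word_sum s (w @ w) = word_sum s w"
    using assms(2) by (simp add: neutral_def)
  then have "length (w @ w) = length w"
    by (rule homogeneousD[OF assms(1)])
  then show False
    using assms(2) by simp
qed

text \<open>A generator has a one-letter word, while a sum of two non-identity elements has a word
  with at least two letters. Conversely, if a word for an irreducible element had several letters,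
  its first letter and the rest would give two non-identity summands.\<close>

lemma homogeneous_imp_admissible:
  fixes s :: "'i \<Rightarrow> 'a::ab_semigroup_add"
  assumes gen: "system_of_generators UNIV (+) UNIV s" and hom: "homogeneous s"
  shows "admissible s"
  unfolding admissible_def
proof (rule subset_antisym; rule subsetI)
  fix x assume "x \<in> range s"
  then obtain i where x: "x = s i"
    by blast
  have wi: "word_sum s [i] = Some x"
    by (simp add: x)
  have "\<not> (\<exists>a b. \<not> neutral UNIV (+) a \<and> \<not> neutral UNIV (+) b \<and> x = a + b)"
  proof safe
    fix a b assume ab: "\<not> neutral UNIV (+) a" "\<not> neutral UNIV (+) b" "x = a + b"
    obtain u where u: "word_sum s u = Some a"
      using neutral_or_word_sum[OF gen, of a] ab(1) by metis
    obtain v where v: "word_sum s v = Some b"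
      using neutral_or_word_sum[OF gen, of b] ab(2) by metis
    have "word_sum s (u @ v) = word_sum s [i]"
      unfolding wi by (simp add: u v ab(3))
    then have "length (u @ v) = length [i]"
      by (rule homogeneousD[OF hom])
    moreover have "length u \<noteq> 0" "length v \<noteq> 0"
      using u v by auto
    ultimately show False
      by simp
  qed
  then show "x \<in> irreducible_elements"
    using homogeneous_not_neutral[OF hom wi] by (simp add: irreducible_elements_def)
next
  fix x :: 'a assume x: "x \<in> irreducible_elements"
  then have "\<not> neutral UNIV (+) x"
    by (simp add: irreducible_elements_def)
  then obtain w where w: "word_sum s w = Some x"
    using neutral_or_word_sum[OF gen, of x] by metis
  then obtain i v where iv: "w = i # v"
    by (cases w) auto
  show "x \<in> range s"
  proof (cases "word_sum s v")
    case None
    then have "x = s i"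
      using w iv by simp
    then show ?thesis
      by (rule range_eqI)
  next
    case (Some h)
    then have "x = s i + h"
      using w iv by simp
    moreover have "\<not> neutral UNIV (+) (s i)"
      by (rule homogeneous_not_neutral[OF hom, of "[i]"]) simp
    moreover have "\<not> neutral UNIV (+) h"
      by (rule homogeneous_not_neutral[OF hom Some])
    ultimately show ?thesis
      using x unfolding irreducible_elements_def by blast
  qed
qed

text \<open>The given generators themselves exhibit the branching graph. An identity of G has only
  the empty word, since nonempty words never sum to it; if there is none, \<open>None\<close> is
  adjoined.\<close>

lemma homogeneous_imp_branching:
  fixes s :: "'i::finite \<Rightarrow> 'a::ab_semigroup_add"
  assumes gen: "system_of_generators UNIV (+) UNIV s" and hom: "homogeneous s"
  shows "branching_semigroup TYPE('a)"
proof -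
  \<comment> \<open>\<open>branching_monoid\<close> asks for generators indexed by naturals, so the
    index type is enumerated.\<close>
  obtain h where h: "bij_betw h {..<card (UNIV :: 'i set)} (UNIV :: 'i set)"
    using ex_bij_betw_nat_finite[of "UNIV :: 'i set"] by (auto simp: atLeast0LessThan)
  let ?I = "{..<card (UNIV :: 'i set)}"
  have I: "finite ?I" "?I \<noteq> {}"
    by (auto simp: lessThan_empty_iff)
  have lift: "\<exists>v. set v \<subseteq> ?I \<and> map h v = w" for w
  proof -
    have "h (inv_into ?I h i) = i" "inv_into ?I h i \<in> ?I" for i
      using bij_betw_inv_into_right[OF h] bij_betwE[OF bij_betw_inv_into[OF h]] by auto
    then show ?thesis
      by (intro exI[of _ "map (inv_into ?I h) w"]) (auto simp: comp_def)
  qed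
  show ?thesis
  proof (cases "\<exists>e::'a. neutral UNIV (+) e")
    case True
    then obtain e :: 'a where e: "neutral UNIV (+) e"
      by blast
    let ?M = "\<lparr>carrier = UNIV, mult = (+), one = e\<rparr>"
    let ?t = "\<lambda>k. s (h k)"
    have monoid: "comm_monoid ?M"
      using e by (intro comm_monoidI) (auto simp: neutral_def ac_simps)
    \<comment> \<open>Folding starts at \<open>e\<close>, whereas \<open>word_sum\<close> starts at
      \<open>None\<close>; for nonempty words the difference disappears.\<close>
    have endpoint: "Some (endpoint ?M ?t w) = option_add (Some e) (word_sum s (map h w))" for w
    proof (induction w rule: rev_induct)
      case (snoc i w)
      from snoc[symmetric] show ?case
        by (simp add: endpoint_snoc flip: option_add_assoc)
    qed simp
    have endpoint': "word_sum s (map h w) = Some (endpoint ?M ?t w)" if w: "w \<noteq> []" for w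
    proof -
      obtain g where "word_sum s (map h w) = Some g"
        using word_sum_neq_Nil[of "map h w" s] w by auto
      then show ?thesis
        using endpoint[of w] e by (simp add: neutral_def)
    qed
    have ne: "endpoint ?M ?t w \<noteq> e" if "w \<noteq> []" for w
      using homogeneous_not_neutral[OF hom endpoint'[OF that]] e by metis
    have "branching_monoid ?M"
    proof (rule branching_monoidI[OF monoid I, of ?t])
      show "\<exists>w. set w \<subseteq> ?I \<and> x = endpoint ?M ?t w" if "x \<in> carrier ?M" for x
      proof (cases rule: neutral_or_word_sum[OF gen, of x])
        case 1
        then have "x = e"
          using neutral_unique e by blast
        then show ?thesis
          by (intro exI[of _ "[]"]) simp
      next
        case (2 w)
        obtain v where v: "set v \<subseteq> ?I" "map h v = w"
          using lift by blast
        have "v \<noteq> []"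
          using 2 v by auto
        then show ?thesis
          using endpoint'[of v] 2 v by (intro exI[of _ v]) simp
      qed
      show "length u = length v"
        if "set u \<subseteq> ?I" "set v \<subseteq> ?I" and uv: "endpoint ?M ?t u = endpoint ?M ?t v" for u v
      proof (cases "u = [] \<or> v = []")
        case True
        then have "u = [] \<and> v = []"
          using uv ne[of u] ne[of v] by (metis endpoint_Nil monoid.select_convs(2))
        then show ?thesis by simp
      next
        case False
        then have "word_sum s (map h u) = word_sum s (map h v)"
          using endpoint'[of u] endpoint'[of v] uv by simp
        then have "length (map h u) = length (map h v)"
          by (rule homogeneousD[OF hom])
        then show ?thesis
          by simp
      qed
    qed simp
    then show ?thesis
      unfolding branching_semigroup_def by blast
  next
    case False
    let ?M = "\<lparr>carrier = UNIV, mult = option_add, one = None\<rparr> :: 'a option monoid"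
    let ?t = "\<lambda>k. Some (s (h k))"
    have monoid: "comm_monoid ?M"
      by (intro comm_monoidI) (simp_all add: option_add_ac)
    have endpoint: "endpoint ?M ?t w = word_sum s (map h w)" for w
      by (induction w rule: rev_induct) (simp_all add: endpoint_snoc)
    have "branching_monoid ?M"
    proof (rule branching_monoidI[OF monoid I, of ?t])
      show "\<exists>w. set w \<subseteq> ?I \<and> x = endpoint ?M ?t w" for x
      proof -
        have "\<exists>w. x = word_sum s w"
        proof (cases x)
          case None
          then show ?thesis
            by (intro exI[of _ "[]"]) simp
        next
          case (Some g)
          then show ?thesis
            using neutral_or_word_sum[OF gen, of g] False by metis
        qed
        then show ?thesis
          unfolding endpoint using lift by metis
      qed
      show "length u = length v" if "endpoint ?M ?t u = endpoint ?M ?t v" for u v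
        using homogeneousD[OF hom, of "map h u" "map h v"] that by (simp add: endpoint)
    qed simp
    moreover have "bij_betw Some (UNIV :: 'a set) (carrier ?M - {one ?M})"
      by (simp add: bij_betw_def UNIV_option_conv)
    moreover have "Some (a + b) = mult ?M (Some a) (Some b)" for a b :: 'a
      by simp
    ultimately show ?thesis
      unfolding branching_semigroup_def by blast
  qed
qed

theorem homogeneous_iff_branching:
  fixes s :: "'i::finite \<Rightarrow> 'a::ab_semigroup_add"
  assumes "system_of_generators UNIV (+) UNIV s"
  shows "homogeneous s \<longleftrightarrow> branching_semigroup TYPE('a) \<and> admissible s"
  using assms homogeneous_imp_branching homogeneous_imp_admissible branching_imp_homogeneous by blast

theorem theorem3:
  fixes s :: "'i::{finite, discrete_topology} \<Rightarrow> 'a::ab_semigroup_add"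
  assumes "system_of_generators UNIV (+) UNIV s"
  shows "compactin weak_topology (absolute s) \<and>
    (\<exists>d. (if branching_semigroup TYPE('a) \<and> admissible s
           then d + 1 = abelian_rank TYPE('a fraction_group)
           else d = abelian_rank TYPE('a fraction_group)) \<and>
         subtopology weak_topology (absolute_main_part s) homeomorphic_space open_disk d)"
  using compactin_absolute[of s] positive_central_vectors_homeomorphic_open_disk[OF assms]
    homeomorphic_space_trans[OF main_part_homeomorphic_positive_central_vectors]
  unfolding homogeneous_iff_branching[OF assms] by blast

end
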